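(* Let $K$ be a field and let $H=(H^0,H^1,s,r)$ be a connected hypergraph such that $|s(h)|\geq 2$ and $|r(h)|\geq 2$ for any $h\in H^1$. Then the Leavitt path algebra $L_K(H)$ is a prime ring.
   Context: Algebras are associative but not necessarily unital. A multiset over a set $Y$ is a function $M:Y\to\mathbb N_0$; its support is $M_{\mathrm{supp}}=\{y\in Y\mid M(y)>0\}$. $\mathrm{Mult}(Y)$ is the set of multisets over $Y$ with finite, nonempty support, and $|M|=\sum_{y\in M_{\mathrm{supp}}}M(y)$. A (directed) hypergraph is a quadruple $H=(H^0,H^1,s,r)$ where $H^0,H^1$ are sets and $s,r:H^1\to\mathrm{Mult}(H^0)$ are maps. All hypergraphs are assumed nonempty (not $H^0=H^1=\emptyset$). For each $h\in H^1$ fix listings with multiplicity $s(h)=\{s(h)_1,\dots,s(h)_{|s(h)|}\}$ and $r(h)=\{r(h)_1,\dots,r(h)_{|r(h)|}\}$. The Leavitt path algebra $L_K(H)$ is the (not necessarily unital) $K$-algebra presented by the generators $v,h_{ij},h_{ij}^*$ ($v\in H^0$, $h\in H^1$, $1\le i\le|s(h)|$, $1\le j\le|r(h)|$) and the relations: (i) $uv=\delta_{uv}u$ ($u,v\in H^0$); (ii) $s(h)_ih_{ij}=h_{ij}=h_{ij}r(h)_j$ and $r(h)_jh_{ij}^*=h_{ij}^*=h_{ij}^*s(h)_i$ for all $h,i,j$; (iii) $\sum_{k=1}^{|r(h)|}h_{ik}h_{jk}^*=\delta_{ij}s(h)_i$ ($h\in H^1$, $1\le i,j\le|s(h)|$);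 (iv) $\sum_{k=1}^{|s(h)|}h_{ki}^*h_{kj}=\delta_{ij}r(h)_i$ ($h\in H^1$, $1\le i,j\le|r(h)|$). Let $\hat E$ be the directed graph with vertex set $H^0$ and edges all $h_{ij}$ (with source $s(h)_i$ and range $r(h)_j$) and all $h_{ij}^*$ (with source $r(h)_j$ and range $s(h)_i$). $H$ is connected if for any $v,w\in H^0$ there is a (possibly trivial) directed path in $\hat E$ from $v$ to $w$. A nonzero ring $R$ is prime if $IJ=\{0\}$ implies $I=\{0\}$ or $J=\{0\}$ for any two-sided ideals $I,J$ of $R$; equivalently (for the rings considered), $xRy=\{0\}$ implies $x=0$ or $y=0$. *)

theory Defs
  imports
    "HOL-Library.Multiset"
    "HOL-Library.Poly_Mapping"
    "HOL-Algebra.Ideal_Product"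
    "HOL-Algebra.QuotRing"
    "HOL-Algebra.Module"
    "Graph_Theory.Arc_Walk"
begin

section \<open>Rings without unit and primeness\<close>

text \<open>
  The locale \<^locale>\<open>ring\<close> requires a unit, whereas the algebras considered here need not have
  one. The record types of \<^theory>\<open>HOL-Algebra.Ring\<close> are reused; the field \<open>one\<close> carries no
  meaning in what follows.
\<close>

locale nonunital_ring = abelian_group R for R (structure) +
  assumes m_closed: "\<lbrakk>x \<in> carrier R; y \<in> carrier R\<rbrakk> \<Longrightarrow> x \<otimes> y \<in> carrier R"
    and m_assoc: "\<lbrakk>x \<in> carrier R; y \<in> carrier R; z \<in> carrier R\<rbrakk>
      \<Longrightarrow> (x \<otimes> y) \<otimes> z = x \<otimes> (y \<otimes> z)"
    and l_distr: "\<lbrakk>x \<in> carrier R; y \<in> carrier R; z \<in> carrier R\<rbrakk>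
      \<Longrightarrow> (x \<oplus> y) \<otimes> z = x \<otimes> z \<oplus> y \<otimes> z"
    and r_distr: "\<lbrakk>x \<in> carrier R; y \<in> carrier R; z \<in> carrier R\<rbrakk>
      \<Longrightarrow> z \<otimes> (x \<oplus> y) = z \<otimes> x \<oplus> z \<otimes> y"

locale two_sided_ideal = additive_subgroup I R + nonunital_ring R for I and R (structure) +
  assumes I_l_closed: "\<lbrakk>a \<in> I; x \<in> carrier R\<rbrakk> \<Longrightarrow> x \<otimes> a \<in> I"
    and I_r_closed: "\<lbrakk>a \<in> I; x \<in> carrier R\<rbrakk> \<Longrightarrow> a \<otimes> x \<in> I"

locale prime_ring = nonunital_ring R for R (structure) +
  assumes nonzero: "carrier R \<noteq> {\<zero>}"
    and prime: "\<lbrakk>two_sided_ideal I R; two_sided_ideal J R; I \<cdot> J = {\<zero>}\<rbrakk>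
      \<Longrightarrow> I = {\<zero>} \<or> J = {\<zero>}"


section \<open>The free algebra without unit\<close>

datatype 'g word = Word (letters: "'g list")

instantiation word :: (type) monoid_add
begin

definition zero_word :: "'a word" where
  "0 = Word []"

definition plus_word :: "'a word \<Rightarrow> 'a word \<Rightarrow> 'a word" where
  "u + v = Word (letters u @ letters v)"

instance
  by standard (auto simp: zero_word_def plus_word_def)

end

text \<open>
  With words added by concatenation, the convolution product on \<^typ>\<open>'g word \<Rightarrow>\<^sub>0 'k\<close> makes
  this type the free unital algebra on \<^typ>\<open>'g\<close>. The free algebra without unit on a set \<open>X\<close>
  consists of the elements supported on nonempty words in \<open>X\<close>.
\<close>

definition free_algebra :: "'g set \<Rightarrow> ('k::field, 'g word \<Rightarrow>\<^sub>0 'k) module" where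
  "free_algebra X =
    \<lparr>carrier = {p. \<forall>w \<in> Poly_Mapping.keys p. letters w \<noteq> [] \<and> set (letters w) \<subseteq> X},
     mult = (*), one = undefined, zero = 0, add = (+),
     smult = (\<lambda>c. Poly_Mapping.map ((*) c))\<rparr>"

definition generator :: "'g \<Rightarrow> 'g word \<Rightarrow>\<^sub>0 'k::field" where
  "generator x = Poly_Mapping.single (Word [x]) 1"


section \<open>Quotients and presentations of algebras\<close>

definition algebra_ideal :: "'a set \<Rightarrow> ('k, 'a) module \<Rightarrow> bool" where
  "algebra_ideal I A \<longleftrightarrow> two_sided_ideal I A \<and> (\<forall>c. \<forall>x \<in> I. c \<odot>\<^bsub>A\<^esub> x \<in> I)"

definition generated_ideal :: "('k, 'a) module \<Rightarrow> 'a set \<Rightarrow> 'a set" where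
  "generated_ideal A S = \<Inter>{I. algebra_ideal I A \<and> S \<subseteq> I}"

definition quotient_algebra :: "('k, 'a) module \<Rightarrow> 'a set \<Rightarrow> ('k, 'a set) module" where
  "quotient_algebra A I =
    ring.extend (A Quot I) (module.fields (\<lambda>c X. \<Union>x \<in> X. I +>\<^bsub>A\<^esub> (c \<odot>\<^bsub>A\<^esub> x)))"

text \<open>An element \<open>r\<close> of \<open>S\<close> stands for the relation \<open>r = 0\<close>.\<close>

definition presented_algebra ::
  "'g set \<Rightarrow> ('g word \<Rightarrow>\<^sub>0 'k::field) set \<Rightarrow> ('k, ('g word \<Rightarrow>\<^sub>0 'k) set) module" where
  "presented_algebra X S = quotient_algebra (free_algebra X) (generated_ideal (free_algebra X) S)"


section \<open>Hypergraphs\<close>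

record ('v, 'e) hypergraph =
  hverts :: "'v set"
  hedges :: "'e set"
  hsource :: "'e \<Rightarrow> 'v multiset"
  hrange :: "'e \<Rightarrow> 'v multiset"

locale hypergraph =
  fixes H :: "('v, 'e) hypergraph"
  assumes nonempty: "\<not> (hverts H = {} \<and> hedges H = {})"
    and hsource: "h \<in> hedges H \<Longrightarrow> hsource H h \<noteq> {#} \<and> set_mset (hsource H h) \<subseteq> hverts H"
    and hrange: "h \<in> hedges H \<Longrightarrow> hrange H h \<noteq> {#} \<and> set_mset (hrange H h) \<subseteq> hverts H"

text \<open>
  The lists \<open>sl h\<close> and \<open>rl h\<close> are the chosen listings with multiplicity of the source and of
  the range of \<open>h\<close>. List positions, and hence the indices of the generators below, start at
  \<open>0\<close> and not at \<open>1\<close>.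
\<close>

definition listings ::
  "('v, 'e) hypergraph \<Rightarrow> ('e \<Rightarrow> 'v list) \<Rightarrow> ('e \<Rightarrow> 'v list) \<Rightarrow> bool" where
  "listings H sl rl \<longleftrightarrow>
    (\<forall>h \<in> hedges H. mset (sl h) = hsource H h \<and> mset (rl h) = hrange H h)"

datatype ('v, 'e) lpa_gen =
  Vertex 'v
| Edge 'e nat nat
| Ghost 'e nat nat

definition edge_gens :: "('v, 'e) hypergraph \<Rightarrow> ('v, 'e) lpa_gen set" where
  "edge_gens H =
    {Edge h i j | h i j. h \<in> hedges H \<and> i < size (hsource H h) \<and> j < size (hrange H h)} \<union>
    {Ghost h i j | h i j. h \<in> hedges H \<and> i < size (hsource H h) \<and> j < size (hrange H h)}"

text \<open>
  The directed graph with arcs \<open>Edge h i j\<close> from \<open>sl h ! i\<close> to \<open>rl h ! j\<close> and \<open>Ghost h i j\<close> in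
  the opposite direction. The clauses for \<^const>\<open>Vertex\<close> are irrelevant: vertices are not arcs.
\<close>

fun gen_tail :: "('e \<Rightarrow> 'v list) \<Rightarrow> ('e \<Rightarrow> 'v list) \<Rightarrow> ('v, 'e) lpa_gen \<Rightarrow> 'v" where
  "gen_tail sl rl (Edge h i j) = sl h ! i"
| "gen_tail sl rl (Ghost h i j) = rl h ! j"
| "gen_tail sl rl (Vertex v) = v"

fun gen_head :: "('e \<Rightarrow> 'v list) \<Rightarrow> ('e \<Rightarrow> 'v list) \<Rightarrow> ('v, 'e) lpa_gen \<Rightarrow> 'v" where
  "gen_head sl rl (Edge h i j) = rl h ! j"
| "gen_head sl rl (Ghost h i j) = sl h ! i"
| "gen_head sl rl (Vertex v) = v"

definition double_graph :: "('v, 'e) hypergraph \<Rightarrow> ('e \<Rightarrow> 'v list) \<Rightarrow> ('e \<Rightarrow> 'v list)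
    \<Rightarrow> ('v, ('v, 'e) lpa_gen) pre_digraph" where
  "double_graph H sl rl =
    \<lparr>verts = hverts H, arcs = edge_gens H, tail = gen_tail sl rl, head = gen_head sl rl\<rparr>"

definition connected_hypergraph ::
  "('v, 'e) hypergraph \<Rightarrow> ('e \<Rightarrow> 'v list) \<Rightarrow> ('e \<Rightarrow> 'v list) \<Rightarrow> bool" where
  "connected_hypergraph H sl rl \<longleftrightarrow>
    (\<forall>v \<in> hverts H. \<forall>w \<in> hverts H. \<exists>p. pre_digraph.awalk (double_graph H sl rl) v p w)"


section \<open>Leavitt path algebras of hypergraphs\<close>

definition lpa_gens :: "('v, 'e) hypergraph \<Rightarrow> ('v, 'e) lpa_gen set" where
  "lpa_gens H = Vertex ` hverts H \<union> edge_gens H"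

abbreviation vertex_elt :: "'v \<Rightarrow> ('v, 'e) lpa_gen word \<Rightarrow>\<^sub>0 'k::field" where
  "vertex_elt v \<equiv> generator (Vertex v)"

abbreviation edge_elt :: "'e \<Rightarrow> nat \<Rightarrow> nat \<Rightarrow> ('v, 'e) lpa_gen word \<Rightarrow>\<^sub>0 'k::field" where
  "edge_elt h i j \<equiv> generator (Edge h i j)"

abbreviation ghost_elt :: "'e \<Rightarrow> nat \<Rightarrow> nat \<Rightarrow> ('v, 'e) lpa_gen word \<Rightarrow>\<^sub>0 'k::field" where
  "ghost_elt h i j \<equiv> generator (Ghost h i j)"

inductive_set lpa_rels :: "('v, 'e) hypergraph \<Rightarrow> ('e \<Rightarrow> 'v list) \<Rightarrow> ('e \<Rightarrow> 'v list)
    \<Rightarrow> (('v, 'e) lpa_gen word \<Rightarrow>\<^sub>0 'k::field) set"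
  for H sl rl
where
  vertices: "\<lbrakk>u \<in> hverts H; v \<in> hverts H\<rbrakk> \<Longrightarrow>
    vertex_elt u * vertex_elt v - (if u = v then vertex_elt u else 0) \<in> lpa_rels H sl rl"
| source_edge: "\<lbrakk>h \<in> hedges H; i < size (hsource H h); j < size (hrange H h)\<rbrakk> \<Longrightarrow>
    vertex_elt (sl h ! i) * edge_elt h i j - edge_elt h i j \<in> lpa_rels H sl rl"
| edge_range: "\<lbrakk>h \<in> hedges H; i < size (hsource H h); j < size (hrange H h)\<rbrakk> \<Longrightarrow>
    edge_elt h i j * vertex_elt (rl h ! j) - edge_elt h i j \<in> lpa_rels H sl rl"
| range_ghost: "\<lbrakk>h \<in> hedges H; i < size (hsource H h); j < size (hrange H h)\<rbrakk> \<Longrightarrow>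
    vertex_elt (rl h ! j) * ghost_elt h i j - ghost_elt h i j \<in> lpa_rels H sl rl"
| ghost_source: "\<lbrakk>h \<in> hedges H; i < size (hsource H h); j < size (hrange H h)\<rbrakk> \<Longrightarrow>
    ghost_elt h i j * vertex_elt (sl h ! i) - ghost_elt h i j \<in> lpa_rels H sl rl"
| edge_ghost: "\<lbrakk>h \<in> hedges H; i < size (hsource H h); j < size (hsource H h)\<rbrakk> \<Longrightarrow>
    (\<Sum>k<size (hrange H h). edge_elt h i k * ghost_elt h j k)
      - (if i = j then vertex_elt (sl h ! i) else 0) \<in> lpa_rels H sl rl"
| ghost_edge: "\<lbrakk>h \<in> hedges H; i < size (hrange H h); j < size (hrange H h)\<rbrakk> \<Longrightarrow>
    (\<Sum>k<size (hsource H h). ghost_elt h k i * edge_elt h k j)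
      - (if i = j then vertex_elt (rl h ! i) else 0) \<in> lpa_rels H sl rl"

definition leavitt_path_algebra ::
  "('v, 'e) hypergraph \<Rightarrow> ('e \<Rightarrow> 'v list) \<Rightarrow> ('e \<Rightarrow> 'v list)
    \<Rightarrow> ('k::field, (('v, 'e) lpa_gen word \<Rightarrow>\<^sub>0 'k) set) module" where
  "leavitt_path_algebra H sl rl = presented_algebra (lpa_gens H) (lpa_rels H sl rl)"

end

theory Submission
  imports Defs
begin

text \<open>
  Let the algebra act from the left on the span of the normal words of a rewriting system for its
  relations; this action is faithful. If every hyperedge has at least two sources and two ranges,
  then lengths of normal forms add up: the product of the top-degree parts of two elements that
  meet in a common vertex does not vanish, because a nonzero scalar matrix of size at least two
  does not have rank one. Hence \<open>x v \<noteq> 0\<close> and \<open>v y \<noteq> 0\<close> imply \<open>x v y \<noteq> 0\<close>. Inserting a path of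
  the double graph between the vertices at which two nonzero elements \<open>x\<close>, \<open>y\<close> live gives some
  \<open>r\<close> with \<open>x r y \<noteq> 0\<close>.
\<close>

section \<open>Ideals and quotients of rings without unit\<close>

sublocale two_sided_ideal \<subseteq> abelian_subgroup I R
  by (intro abelian_subgroupI3 is_additive_subgroup abelian_group_axioms)

context two_sided_ideal
begin

lemma rcoset_mult_rcos:
  assumes "x \<in> carrier R" "y \<in> carrier R"
  shows "rcoset_mult R I (I +> x) (I +> y) = I +> (x \<otimes> y)"
proof -
  have *: "I +> (x' \<otimes> y') = I +> (x \<otimes> y)" if "x' \<in> I +> x" "y' \<in> I +> y" for x' y'
  proof -
    from that obtain hx hy where h: "hx \<in> I" "x' = hx \<oplus> x" "hy \<in> I" "y' = hy \<oplus> y"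
      by (auto simp: a_r_coset_def')
    have c: "hx \<in> carrier R" "hy \<in> carrier R"
      using h a_subset by auto
    have "x' \<otimes> y' = hx \<otimes> (hy \<oplus> y) \<oplus> x \<otimes> (hy \<oplus> y)"
      using h c assms by (simp add: l_distr)
    also have "\<dots> = hx \<otimes> (hy \<oplus> y) \<oplus> (x \<otimes> hy \<oplus> x \<otimes> y)"
      using c assms by (simp only: r_distr)
    also have "\<dots> = (hx \<otimes> (hy \<oplus> y) \<oplus> x \<otimes> hy) \<oplus> x \<otimes> y"
      using c assms by (simp add: a_assoc m_closed)
    finally have "x' \<otimes> y' \<in> I +> (x \<otimes> y)"
      using h c assms I_l_closed I_r_closed by (auto simp: a_r_coset_def')
    then show ?thesis
      using assms a_repr_independence[OF _ _ a_subgroup] by (simp add: m_closed)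
  qed
  have "x \<in> I +> x" "y \<in> I +> y"
    using assms by (simp_all add: a_rcos_self)
  with * show ?thesis
    unfolding rcoset_mult_def by blast
qed

lemma rcos_eq_self_iff: "x \<in> carrier R \<Longrightarrow> I +> x = I \<longleftrightarrow> x \<in> I"
  using a_coset_join1 a_coset_join2 a_subgroup by blast

end

lemma quotient_algebra_simps [simp]:
  "carrier (quotient_algebra A I) = a_rcosets\<^bsub>A\<^esub> I"
  "mult (quotient_algebra A I) = rcoset_mult A I"
  "zero (quotient_algebra A I) = I"
  "add (quotient_algebra A I) = set_add A"
  by (simp_all add: quotient_algebra_def ring.defs module.defs FactRing_def)

lemma quotient_algebra_nonunital_ring:
  fixes A (structure)
  assumes "two_sided_ideal I A"
  shows "nonunital_ring (quotient_algebra A I)"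
proof -
  interpret two_sided_ideal I A by fact
  interpret Q: abelian_group "A Quot I"
    by (rule comm_group_abelian_groupI)
      (simp add: FactRing_def a_factorgroup_is_comm_group[unfolded A_FactGroup_def'])
  have "\<exists>y \<in> carrier (A Quot I). y \<oplus>\<^bsub>A Quot I\<^esub> x = \<zero>\<^bsub>A Quot I\<^esub>"
    if "x \<in> carrier (A Quot I)" for x
    using that Q.l_neg Q.a_inv_closed by blast
  then have "abelian_group (quotient_algebra A I)"
    by (intro abelian_groupI)
      (use Q.a_closed Q.zero_closed Q.a_assoc Q.a_comm Q.l_zero in \<open>simp_all add: FactRing_def\<close>)
  then show ?thesis
    by (intro nonunital_ring.intro nonunital_ring_axioms.intro)
      (auto simp: A_RCOSETS_def' rcoset_mult_rcos a_rcos_sum m_assoc l_distr r_distr m_closed)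
qed

lemma quotient_algebra_prime_ring:
  fixes A (structure)
  assumes "two_sided_ideal I A" and "I \<noteq> carrier A"
    and mid: "\<And>x y. \<lbrakk>x \<in> carrier A; y \<in> carrier A; x \<notin> I; y \<notin> I\<rbrakk>
      \<Longrightarrow> \<exists>r \<in> carrier A. x \<otimes> (r \<otimes> y) \<notin> I"
  shows "prime_ring (quotient_algebra A I)"
proof -
  let ?Q = "quotient_algebra A I"
  interpret two_sided_ideal I A by fact
  interpret Q: nonunital_ring ?Q
    by (rule quotient_algebra_nonunital_ring) fact
  have nonzero_rep: "\<exists>x. x \<in> carrier A \<and> x \<notin> I \<and> I +> x \<in> L"
    if "two_sided_ideal L ?Q" "L \<noteq> {\<zero>\<^bsub>?Q\<^esub>}" for L
  proof -
    interpret L: two_sided_ideal L ?Q by fact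
    from that L.zero_closed obtain X where X: "X \<in> L" "X \<noteq> I"
      by auto
    with L.a_subset obtain x where "x \<in> carrier A" "X = I +> x"
      by (auto simp: A_RCOSETS_def')
    with X show ?thesis
      using rcos_eq_self_iff by auto
  qed
  show ?thesis
  proof
    obtain x where "x \<in> carrier A" "x \<notin> I"
      using assms(2) a_subset by blast
    then have "I +> x \<in> carrier ?Q" "I +> x \<noteq> I"
      by (auto simp: A_RCOSETS_def' rcos_eq_self_iff)
    then show "carrier ?Q \<noteq> {\<zero>\<^bsub>?Q\<^esub>}"
      by auto
  next
    fix L M
    assume L: "two_sided_ideal L ?Q" and M: "two_sided_ideal M ?Q"
      and LM: "ideal_prod ?Q L M = {\<zero>\<^bsub>?Q\<^esub>}"
    show "L = {\<zero>\<^bsub>?Q\<^esub>} \<or> M = {\<zero>\<^bsub>?Q\<^esub>}"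
    proof (rule ccontr)
      assume "\<not> ?thesis"
      then obtain x y where x: "x \<in> carrier A" "x \<notin> I" "I +> x \<in> L"
        and y: "y \<in> carrier A" "y \<notin> I" "I +> y \<in> M"
        using nonzero_rep[OF L] nonzero_rep[OF M] by auto
      obtain r where r: "r \<in> carrier A" "x \<otimes> (r \<otimes> y) \<notin> I"
        using mid x y by blast
      have "I +> r \<in> carrier ?Q"
        using r by (auto simp: A_RCOSETS_def')
      then have "(I +> r) \<otimes>\<^bsub>?Q\<^esub> (I +> y) \<in> M"
        using two_sided_ideal.I_l_closed[OF M y(3)] by blast
      then have "I +> (r \<otimes> y) \<in> M"
        using r y by (simp add: rcoset_mult_rcos)
      then have "(I +> x) \<otimes>\<^bsub>?Q\<^esub> (I +> (r \<otimes> y)) \<in> ideal_prod ?Q L M"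
        using x by (intro ideal_prod.prod)
      then have "I +> (x \<otimes> (r \<otimes> y)) = I"
        using LM x y r by (simp add: rcoset_mult_rcos m_closed)
      then show False
        using r x y by (simp add: rcos_eq_self_iff m_closed)
    qed
  qed
qed


section \<open>Ideals of the free algebra\<close>

lemma free_algebra_simps [simp]:
  "mult (free_algebra X) = (*)" "zero (free_algebra X) = 0" "add (free_algebra X) = (+)"
  "smult (free_algebra X) = (\<lambda>c p. Poly_Mapping.single 0 c * p)"
  by (simp_all add: free_algebra_def mult_map_scale_conv_mult fun_eq_iff)

lemma mem_free_algebra:
  "p \<in> carrier (free_algebra X) \<longleftrightarrow>
    (\<forall>w \<in> Poly_Mapping.keys p. letters w \<noteq> [] \<and> set (letters w) \<subseteq> X)"
  by (simp add: free_algebra_def)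

lemma single_in_free_algebra:
  "set l \<subseteq> X \<Longrightarrow> l \<noteq> [] \<Longrightarrow> Poly_Mapping.single (Word l) c \<in> carrier (free_algebra X)"
  by (auto simp: mem_free_algebra)

lemma generator_in_free_algebra: "x \<in> X \<Longrightarrow> generator x \<in> carrier (free_algebra X)"
  by (simp add: generator_def single_in_free_algebra)

lemma lookup_scale:
  "Poly_Mapping.lookup (Poly_Mapping.single 0 c * p) w = (c::'k::semiring_0) * Poly_Mapping.lookup p w"
  by (simp add: mult_map_scale_conv_mult[symmetric] map.rep_eq when_def)

lemma keys_scale: "Poly_Mapping.keys (Poly_Mapping.single 0 c * p) \<subseteq> Poly_Mapping.keys p"
  by (auto simp: in_keys_iff lookup_scale)

lemma zero_in_free_algebra: "0 \<in> carrier (free_algebra X)"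
  by (simp add: mem_free_algebra)

lemma add_in_free_algebra:
  "p \<in> carrier (free_algebra X) \<Longrightarrow> q \<in> carrier (free_algebra X) \<Longrightarrow> p + q \<in> carrier (free_algebra X)"
  using Poly_Mapping.keys_add[of p q] unfolding mem_free_algebra by blast

lemma uminus_in_free_algebra: "p \<in> carrier (free_algebra X) \<Longrightarrow> - p \<in> carrier (free_algebra X)"
  by (simp add: mem_free_algebra keys_minus)

lemma diff_in_free_algebra:
  "p \<in> carrier (free_algebra X) \<Longrightarrow> q \<in> carrier (free_algebra X) \<Longrightarrow> p - q \<in> carrier (free_algebra X)"
  using add_in_free_algebra[of p X "- q"] by (simp add: uminus_in_free_algebra)

lemma sum_in_free_algebra:
  "(\<And>i. i \<in> S \<Longrightarrow> f i \<in> carrier (free_algebra X)) \<Longrightarrow> sum f S \<in> carrier (free_algebra X)"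
  by (induction S rule: infinite_finite_induct) (auto simp: zero_in_free_algebra add_in_free_algebra)

lemma mult_in_free_algebra:
  assumes "p \<in> carrier (free_algebra X)" "q \<in> carrier (free_algebra X)"
  shows "p * q \<in> carrier (free_algebra X)"
  unfolding mem_free_algebra
proof
  fix w assume "w \<in> Poly_Mapping.keys (p * q)"
  then obtain u v where "u \<in> Poly_Mapping.keys p" "v \<in> Poly_Mapping.keys q" "w = u + v"
    using keys_mult[of p q] by blast
  then show "letters w \<noteq> [] \<and> set (letters w) \<subseteq> X"
    using assms unfolding mem_free_algebra by (auto simp: plus_word_def)
qed

lemma scale_in_free_algebra:
  "p \<in> carrier (free_algebra X) \<Longrightarrow> Poly_Mapping.single 0 c * p \<in> carrier (free_algebra X)"
  using keys_scale unfolding mem_free_algebra by blast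

lemma free_algebra_nonunital_ring: "nonunital_ring (free_algebra X)"
proof -
  have "abelian_group (free_algebra X)"
    by (rule abelian_groupI)
      (auto simp: add_in_free_algebra zero_in_free_algebra algebra_simps
        intro!: bexI[OF _ uminus_in_free_algebra])
  then show ?thesis
    by (intro nonunital_ring.intro nonunital_ring_axioms.intro)
      (auto simp: mult_in_free_algebra algebra_simps)
qed

lemma a_inv_free_algebra:
  assumes "p \<in> carrier (free_algebra X)"
  shows "\<ominus>\<^bsub>free_algebra X\<^esub> p = - p"
proof -
  interpret nonunital_ring "free_algebra X"
    by (rule free_algebra_nonunital_ring)
  show ?thesis
    using assms minus_equality[of "- p" p] by (simp add: uminus_in_free_algebra)
qed

lemma algebra_ideal_free_algebraI:
  assumes "I \<subseteq> carrier (free_algebra X)" "0 \<in> I"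
    and "\<And>p q. p \<in> I \<Longrightarrow> q \<in> I \<Longrightarrow> p + q \<in> I"
    and scale: "\<And>c p. p \<in> I \<Longrightarrow> Poly_Mapping.single 0 c * p \<in> I"
    and "\<And>p q. p \<in> I \<Longrightarrow> q \<in> carrier (free_algebra X) \<Longrightarrow> q * p \<in> I"
    and "\<And>p q. p \<in> I \<Longrightarrow> q \<in> carrier (free_algebra X) \<Longrightarrow> p * q \<in> I"
  shows "algebra_ideal I (free_algebra X :: ('k::field, 'g word \<Rightarrow>\<^sub>0 'k) module)"
proof -
  interpret nonunital_ring "free_algebra X :: ('k, 'g word \<Rightarrow>\<^sub>0 'k) module"
    by (rule free_algebra_nonunital_ring)
  have neg: "- p \<in> I" if "p \<in> I" for p
    using scale[OF that, of "- 1"] by (simp add: single_uminus)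
  have "inv\<^bsub>add_monoid (free_algebra X :: ('k, 'g word \<Rightarrow>\<^sub>0 'k) module)\<^esub> p = - p" if "p \<in> I" for p
    using a_inv_free_algebra that assms(1) unfolding a_inv_def by blast
  then have "subgroup I (add_monoid (free_algebra X))"
    using assms neg by (intro group.subgroupI[OF a_group]) auto
  then show ?thesis
    using assms
    by (auto simp: algebra_ideal_def additive_subgroupI intro!: two_sided_ideal.intro
        nonunital_ring_axioms two_sided_ideal_axioms.intro)
qed

lemma
  assumes "algebra_ideal I (free_algebra X)"
  shows algebra_ideal_zero: "0 \<in> I"
    and algebra_ideal_add: "p \<in> I \<Longrightarrow> q \<in> I \<Longrightarrow> p + q \<in> I"
    and algebra_ideal_scale: "p \<in> I \<Longrightarrow> Poly_Mapping.single 0 c * p \<in> I"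
    and algebra_ideal_mult_left: "p \<in> I \<Longrightarrow> q \<in> carrier (free_algebra X) \<Longrightarrow> q * p \<in> I"
    and algebra_ideal_mult_right: "p \<in> I \<Longrightarrow> q \<in> carrier (free_algebra X) \<Longrightarrow> p * q \<in> I"
proof -
  interpret two_sided_ideal I "free_algebra X"
    using assms by (simp add: algebra_ideal_def)
  show "0 \<in> I" using additive_subgroup.zero_closed[OF is_additive_subgroup] by simp
  show "p \<in> I \<Longrightarrow> q \<in> I \<Longrightarrow> p + q \<in> I"
    using additive_subgroup.a_closed[OF is_additive_subgroup] by simp
  show "p \<in> I \<Longrightarrow> Poly_Mapping.single 0 c * p \<in> I"
    using assms by (auto simp: algebra_ideal_def)
  show "p \<in> I \<Longrightarrow> q \<in> carrier (free_algebra X) \<Longrightarrow> q * p \<in> I" using I_l_closed by simp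
  show "p \<in> I \<Longrightarrow> q \<in> carrier (free_algebra X) \<Longrightarrow> p * q \<in> I" using I_r_closed by simp
qed

lemma algebra_ideal_free_algebra_carrier: "algebra_ideal (carrier (free_algebra X)) (free_algebra X)"
  by (rule algebra_ideal_free_algebraI)
    (auto intro: zero_in_free_algebra add_in_free_algebra scale_in_free_algebra mult_in_free_algebra)

lemma generated_ideal_least:
  "algebra_ideal J A \<Longrightarrow> S \<subseteq> J \<Longrightarrow> generated_ideal A S \<subseteq> J"
  by (auto simp: generated_ideal_def)

lemma generated_ideal_superset: "S \<subseteq> generated_ideal A S"
  by (auto simp: generated_ideal_def)

lemma algebra_ideal_generated_ideal:
  assumes "S \<subseteq> carrier (free_algebra X)"
  shows "algebra_ideal (generated_ideal (free_algebra X) S) (free_algebra X)"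
proof (rule algebra_ideal_free_algebraI)
  show "generated_ideal (free_algebra X) S \<subseteq> carrier (free_algebra X)"
    by (rule generated_ideal_least[OF algebra_ideal_free_algebra_carrier assms])
qed (auto simp: generated_ideal_def intro: algebra_ideal_zero algebra_ideal_add algebra_ideal_scale
      algebra_ideal_mult_left algebra_ideal_mult_right)

section \<open>Linear maps between free algebras\<close>

definition klinear :: "(('a::monoid_add \<Rightarrow>\<^sub>0 'k::field) \<Rightarrow> ('b::monoid_add \<Rightarrow>\<^sub>0 'k)) \<Rightarrow> bool" where
  "klinear T \<longleftrightarrow> (\<forall>p q. T (p + q) = T p + T q) \<and>
    (\<forall>c p. T (Poly_Mapping.single 0 c * p) = Poly_Mapping.single 0 c * T p)"

lemma klinear_add: "klinear T \<Longrightarrow> T (p + q) = T p + T q"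
  and klinear_scale: "klinear T \<Longrightarrow> T (Poly_Mapping.single 0 c * p) = Poly_Mapping.single 0 c * T p"
  by (auto simp: klinear_def)

lemma klinear_zero: "klinear T \<Longrightarrow> T 0 = 0"
  using klinear_scale[of T 0 0] by simp

lemma klinear_uminus: "klinear T \<Longrightarrow> T (- p) = - T p"
  using klinear_scale[of T "- 1" p] by (simp add: single_uminus)

lemma klinear_diff: "klinear T \<Longrightarrow> T (p - q) = T p - T q"
  using klinear_add[of T p "- q"] by (simp add: klinear_uminus)

lemma klinear_sum: "klinear T \<Longrightarrow> T (sum f S) = (\<Sum>i\<in>S. T (f i))"
  by (induction S rule: infinite_finite_induct) (auto simp: klinear_zero klinear_add)

lemma klinear_comp: "klinear S \<Longrightarrow> klinear T \<Longrightarrow> klinear (\<lambda>x. S (T x))"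
  by (simp add: klinear_def)

lemma poly_mapping_eq_sum_singles:
  "p = (\<Sum>w\<in>Poly_Mapping.keys p. Poly_Mapping.single 0 (Poly_Mapping.lookup p w) * Poly_Mapping.single w 1)"
  for p :: "'a::monoid_add \<Rightarrow>\<^sub>0 'k::field"
proof (rule poly_mapping_eqI)
  fix v
  show "Poly_Mapping.lookup p v = Poly_Mapping.lookup (\<Sum>w\<in>Poly_Mapping.keys p.
      Poly_Mapping.single 0 (Poly_Mapping.lookup p w) * Poly_Mapping.single w 1) v"
    by (simp add: lookup_sum mult_single lookup_single when_def in_keys_iff)
qed

lemma single_central:
  "p * Poly_Mapping.single 0 c = Poly_Mapping.single 0 (c :: 'k::field) * (p :: 'a::monoid_add \<Rightarrow>\<^sub>0 'k)"
  by (subst (1 2) poly_mapping_eq_sum_singles)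
    (simp add: sum_distrib_left sum_distrib_right mult_single mult.commute)

lemma scale_left_commute:
  "Poly_Mapping.single 0 b * (Poly_Mapping.single 0 c * p) =
    Poly_Mapping.single 0 c * (Poly_Mapping.single 0 (b :: 'k::field) * (p :: 'a::monoid_add \<Rightarrow>\<^sub>0 'k))"
  by (simp add: mult.assoc[symmetric] mult_single mult.commute)

lemma klinear_expand:
  "klinear T \<Longrightarrow> T p = (\<Sum>w\<in>Poly_Mapping.keys p.
    Poly_Mapping.single 0 (Poly_Mapping.lookup p w) * T (Poly_Mapping.single w 1))"
  by (subst (1) poly_mapping_eq_sum_singles) (simp add: klinear_sum klinear_scale)

lemma klinear_mem_span:
  assumes "klinear T" "0 \<in> V" "\<And>p q. p \<in> V \<Longrightarrow> q \<in> V \<Longrightarrow> p + q \<in> V"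
    and "\<And>c p. p \<in> V \<Longrightarrow> Poly_Mapping.single 0 c * p \<in> V"
    and "\<And>w. w \<in> Poly_Mapping.keys p \<Longrightarrow> T (Poly_Mapping.single w 1) \<in> V"
  shows "T p \<in> V"
proof -
  have sum_mem: "sum f S \<in> V" if "\<And>i. i \<in> S \<Longrightarrow> f i \<in> V" for S and f :: "'a \<Rightarrow> _"
    using that assms(2,3) by (induction S rule: infinite_finite_induct) auto
  show ?thesis
    unfolding klinear_expand[OF assms(1), of p] by (intro sum_mem assms(4,5))
qed

definition lin_ext :: "('a::monoid_add \<Rightarrow> 'b::monoid_add \<Rightarrow>\<^sub>0 'k) \<Rightarrow> ('a \<Rightarrow>\<^sub>0 'k::field) \<Rightarrow> 'b \<Rightarrow>\<^sub>0 'k" where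
  "lin_ext f p = (\<Sum>w\<in>Poly_Mapping.keys p. Poly_Mapping.single 0 (Poly_Mapping.lookup p w) * f w)"

lemma lin_ext_eq_sum:
  assumes "finite S" "Poly_Mapping.keys p \<subseteq> S"
  shows "lin_ext f p = (\<Sum>w\<in>S. Poly_Mapping.single 0 (Poly_Mapping.lookup p w) * f w)"
  unfolding lin_ext_def using assms by (intro sum.mono_neutral_left) (auto simp: in_keys_iff)

lemma klinear_lin_ext: "klinear (lin_ext f)"
  unfolding klinear_def
proof safe
  fix p q
  show "lin_ext f (p + q) = lin_ext f p + lin_ext f q"
    unfolding lin_ext_def
    by (rule setsum_keys_plus_distrib) (simp_all add: single_add algebra_simps)
  fix c
  have "lin_ext f (Poly_Mapping.single 0 c * p) = (\<Sum>w\<in>Poly_Mapping.keys p.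
      Poly_Mapping.single 0 (Poly_Mapping.lookup (Poly_Mapping.single 0 c * p) w) * f w)"
    by (rule lin_ext_eq_sum) (auto simp: keys_scale)
  then show "lin_ext f (Poly_Mapping.single 0 c * p) = Poly_Mapping.single 0 c * lin_ext f p"
    by (simp add: lin_ext_def lookup_scale sum_distrib_left mult.assoc[symmetric] mult_single)
qed

lemma lin_ext_single: "lin_ext f (Poly_Mapping.single w c) = Poly_Mapping.single 0 c * f w"
  by (simp add: lin_ext_def)

lemma lin_ext_single_one [simp]: "lin_ext f (Poly_Mapping.single w 1) = f w"
  by (simp add: lin_ext_single)

lemma klinear_lin_ext_fun:
  "(\<And>w. klinear (f w)) \<Longrightarrow> klinear (\<lambda>n. lin_ext (\<lambda>w. f w n) x)"
  by (simp add: klinear_def lin_ext_def sum.distrib distrib_left sum_distrib_left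
      scale_left_commute)

section \<open>Normal words\<close>

definition arc :: "bool \<Rightarrow> 'e \<Rightarrow> nat \<Rightarrow> nat \<Rightarrow> ('v, 'e) lpa_gen" where
  "arc c h i k = (if c then Edge h i k else Ghost h k i)"

lemma arc_eq_iff [simp]: "arc c h i k = arc c' h' i' k' \<longleftrightarrow> c = c' \<and> h = h' \<and> i = i' \<and> k = k'"
  and arc_neq_Vertex [simp]: "arc c h i k \<noteq> Vertex v" "Vertex v \<noteq> arc c h i k"
  by (auto simp: arc_def)

lemma lpa_gen_cases [case_names Vertex arc]:
  obtains v where "g = Vertex v" | c h i k where "g = arc c h i k"
proof (cases g)
  case (Edge h i k)
  then have "g = arc True h i k" by (simp add: arc_def)
  then show thesis by (rule that(2))
next
  case (Ghost h k i)
  then have "g = arc False h i k" by (simp add: arc_def)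
  then show thesis by (rule that(2))
qed (rule that(1))

definition forb :: "('v, 'e) lpa_gen \<Rightarrow> ('v, 'e) lpa_gen \<Rightarrow> bool" where
  "forb a b \<longleftrightarrow> (\<exists>c h i j. a = arc c h i 0 \<and> b = arc (\<not> c) h 0 j)"

lemma forb_arc [simp]:
  "forb (arc c h i k) (arc c' h' i' k') \<longleftrightarrow> h' = h \<and> c' = (\<not> c) \<and> k = 0 \<and> i' = 0"
  "\<not> forb (Vertex v) b" "\<not> forb b (Vertex v)"
  by (auto simp: forb_def)

lemma forb_Edge: "forb (Edge h i k) b \<longleftrightarrow> (\<exists>j. k = 0 \<and> b = Ghost h j 0)"
  and forb_Ghost: "forb (Ghost h k i) b \<longleftrightarrow> (\<exists>j. k = 0 \<and> b = Edge h 0 j)"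
  by (auto simp: forb_def arc_def)

abbreviation word_elt :: "'g list \<Rightarrow> 'g word \<Rightarrow>\<^sub>0 'k::field" where
  "word_elt l \<equiv> Poly_Mapping.single (Word l) 1"

lemma word_elt_mult: "word_elt l * word_elt m = word_elt (l @ m)"
  by (simp add: mult_single plus_word_def)

lemma word_elt_Nil: "word_elt [] = 1"
  using single_one[where 'a="'g word"] unfolding zero_word_def by simp


locale lpa = hypergraph H for H :: "('v, 'e) hypergraph" +
  fixes sl rl :: "'e \<Rightarrow> 'v list"
  assumes lists: "listings H sl rl"
begin

abbreviation "src \<equiv> gen_tail sl rl"
abbreviation "rng \<equiv> gen_head sl rl"

definition side :: "bool \<Rightarrow> 'e \<Rightarrow> 'v list" where
  "side c h = (if c then sl h else rl h)"

abbreviation deg :: "bool \<Rightarrow> 'e \<Rightarrow> nat" where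
  "deg c h \<equiv> length (side c h)"

lemma src_arc [simp]: "src (arc c h i k) = side c h ! i"
  and rng_arc [simp]: "rng (arc c h i k) = side (\<not> c) h ! k"
  by (simp_all add: arc_def side_def)

lemma size_sides:
  assumes "h \<in> hedges H"
  shows "size (hsource H h) = length (sl h)" "size (hrange H h) = length (rl h)"
  using lists assms unfolding listings_def by (metis size_mset)+

lemma edge_gens_eq: "edge_gens H = {arc c h i k | c h i k. h \<in> hedges H \<and> i < deg c h \<and> k < deg (\<not> c) h}"
proof -
  have "arc c h i k \<in> edge_gens H \<longleftrightarrow> h \<in> hedges H \<and> i < deg c h \<and> k < deg (\<not> c) h" for c h i k
    by (cases c) (auto simp: edge_gens_def arc_def side_def size_sides)
  moreover have "Vertex v \<notin> edge_gens H" for v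
    by (simp add: edge_gens_def)
  ultimately have "g \<in> edge_gens H \<longleftrightarrow>
      (\<exists>c h i k. g = arc c h i k \<and> h \<in> hedges H \<and> i < deg c h \<and> k < deg (\<not> c) h)" for g
    by (cases g rule: lpa_gen_cases) auto
  then show ?thesis by auto
qed

lemma arc_in_edge_gens [simp]:
  "arc c h i k \<in> edge_gens H \<longleftrightarrow> h \<in> hedges H \<and> i < deg c h \<and> k < deg (\<not> c) h"
  by (auto simp: edge_gens_eq)

lemma Vertex_in_lpa_gens [simp]: "Vertex v \<in> lpa_gens H \<longleftrightarrow> v \<in> hverts H"
  and Vertex_not_in_edge_gens [simp]: "Vertex v \<notin> edge_gens H"
  and edge_gens_subset: "a \<in> edge_gens H \<Longrightarrow> a \<in> lpa_gens H"
  by (auto simp: lpa_gens_def edge_gens_eq)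

lemma arc_in_lpa_gens [simp]: "arc c h i k \<in> lpa_gens H \<longleftrightarrow> arc c h i k \<in> edge_gens H"
  by (auto simp: lpa_gens_def)

lemma side_in_hverts: "h \<in> hedges H \<Longrightarrow> i < deg c h \<Longrightarrow> side c h ! i \<in> hverts H"
proof -
  assume h: "h \<in> hedges H" and i: "i < deg c h"
  have "set (side c h) = set_mset (if c then hsource H h else hrange H h)"
    using lists h by (auto simp: listings_def side_def simp flip: set_mset_mset)
  also have "\<dots> \<subseteq> hverts H"
    using hsource[OF h] hrange[OF h] by simp
  finally show ?thesis
    using nth_mem[OF i] by blast
qed

lemma src_rng_in_hverts: "g \<in> lpa_gens H \<Longrightarrow> src g \<in> hverts H \<and> rng g \<in> hverts H"
  by (cases g rule: lpa_gen_cases) (auto simp: side_in_hverts)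

text \<open>
  A normal word carries its end vertex as last letter, so that a trivial path is not empty.
\<close>

inductive_set normal :: "'v \<Rightarrow> ('v, 'e) lpa_gen list set" for v where
  Vertex: "v \<in> hverts H \<Longrightarrow> [Vertex v] \<in> normal v"
| arc: "\<lbrakk>x # l \<in> normal v; a \<in> edge_gens H; rng a = src x; \<not> forb a x\<rbrakk> \<Longrightarrow> a # x # l \<in> normal v"

lemma normal_not_Nil [simp]: "[] \<notin> normal v"
  using normal.cases by blast

lemma normal_subset: "l \<in> normal v \<Longrightarrow> set l \<subseteq> lpa_gens H"
  by (induction rule: normal.induct) (auto simp: edge_gens_subset)

lemma normal_last: "l \<in> normal v \<Longrightarrow> last l = Vertex v"
  by (induction rule: normal.induct) auto

lemma normal_Vertex_Cons [simp]: "Vertex w # l \<in> normal v \<longleftrightarrow> l = [] \<and> w = v \<and> v \<in> hverts H"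
  by (subst normal.simps) auto

lemma normal_arc_Cons [simp]: "arc c h i k # l \<in> normal v \<longleftrightarrow>
    l \<in> normal v \<and> arc c h i k \<in> edge_gens H \<and> side (\<not> c) h ! k = src (hd l) \<and> \<not> forb (arc c h i k) (hd l)"
proof (cases l)
  case Nil
  then show ?thesis by (auto elim: normal.cases)
next
  case (Cons x l')
  show ?thesis
    unfolding Cons by (auto elim: normal.cases intro: normal.arc)
qed

text \<open>
  For a normal word \<open>l\<close>, \<open>lact g l\<close> is the normal form of \<open>g l\<close>. The two families of relations
  \<open>\<Sum>\<^sub>k h\<^sub>i\<^sub>k h\<^sub>j\<^sub>k\<^sup>* = \<delta>\<^sub>i\<^sub>j s(h)\<^sub>i\<close> and
  \<open>\<Sum>\<^sub>k h\<^sub>k\<^sub>i\<^sup>* h\<^sub>k\<^sub>j = \<delta>\<^sub>i\<^sub>j r(h)\<^sub>i\<close> read alike in terms of \<^const>\<open>arc\<close>. They are oriented so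
  that the summand with \<open>k = 0\<close> is the one that is rewritten.
\<close>

fun lact :: "('v, 'e) lpa_gen \<Rightarrow> ('v, 'e) lpa_gen list \<Rightarrow> ('v, 'e) lpa_gen word \<Rightarrow>\<^sub>0 'k::field" where
  "lact g [] = 0"
| "lact g (x # l) =
    (if rng g \<noteq> src x then 0
     else case (g, x) of
       (Vertex w, _) \<Rightarrow> word_elt (x # l)
     | (Edge h i k, Ghost h' j m) \<Rightarrow>
         if h' = h \<and> k = 0 \<and> m = 0
         then (if i = j then word_elt l else 0)
           - (\<Sum>q = 1..<deg False h. word_elt (Edge h i q # Ghost h j q # l))
         else word_elt (g # x # l)
     | (Ghost h k i, Edge h' m j) \<Rightarrow>
         if h' = h \<and> k = 0 \<and> m = 0
         then (if i = j then word_elt l else 0)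
           - (\<Sum>q = 1..<deg True h. word_elt (Ghost h q i # Edge h q j # l))
         else word_elt (g # x # l)
     | _ \<Rightarrow> word_elt (g # x # l))"

declare lact.simps [simp del]

lemma lact_Nil [simp]: "lact g [] = 0"
  by (rule lact.simps)

lemma lact_neq: "rng g \<noteq> src x \<Longrightarrow> lact g (x # l) = 0"
  by (simp add: lact.simps)

lemma lact_Vertex: "lact (Vertex w) (x # l) = (if w = src x then word_elt (x # l) else 0)"
  by (simp add: lact.simps)

lemma lact_free: "rng a = src x \<Longrightarrow> \<not> forb a x \<Longrightarrow> a \<in> edge_gens H \<Longrightarrow> lact a (x # l) = word_elt (a # x # l)"
  by (cases a; cases x) (auto simp: lact.simps forb_Edge forb_Ghost)

lemma lact_forb:
  assumes "side (\<not> c) h ! 0 = src (arc (\<not> c) h 0 j)"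
  shows "lact (arc c h i 0) (arc (\<not> c) h 0 j # l) = (if i = j then word_elt l else 0)
    - (\<Sum>q = 1..<deg (\<not> c) h. word_elt (arc c h i q # arc (\<not> c) h q j # l))"
  by (cases c) (auto simp: lact.simps arc_def side_def)

lemma lact_cases [consumes 2, case_names neq Vertex free forb]:
  assumes "l \<in> normal v" "g \<in> lpa_gens H"
  obtains x l' where "l = x # l'" "rng g \<noteq> src x"
  | x l' where "l = x # l'" "g = Vertex (src x)"
  | x l' where "l = x # l'" "rng g = src x" "\<not> forb g x" "g \<in> edge_gens H"
  | c h i j l' where "g = arc c h i 0" "l = arc (\<not> c) h 0 j # l'" "h \<in> hedges H" "i < deg c h" "j < deg c h"
      "0 < deg (\<not> c) h" "l' \<in> normal v" "side c h ! j = src (hd l')"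
proof -
  obtain x l' where l: "l = x # l'"
    using assms(1) by (cases l) auto
  show thesis
  proof (cases "rng g = src x")
    case True
    show thesis
    proof (cases g rule: lpa_gen_cases)
      case (Vertex v)
      then show thesis using that(2) l True by auto
    next
      case (arc c h i k)
      show thesis
      proof (cases "forb g x")
        case True
        then show thesis using that(4) arc l assms by (auto simp: forb_def)
      next
        case False
        then show thesis using that(3) l \<open>rng g = src x\<close> arc assms by auto
      qed
    qed
  qed (use that l in auto)
qed

end

definition wspan :: "'g list set \<Rightarrow> ('g word \<Rightarrow>\<^sub>0 'k::field) set" where
  "wspan N = {p. \<forall>w \<in> Poly_Mapping.keys p. letters w \<in> N}"

lemma wspan_zero [simp]: "0 \<in> wspan N"
  by (simp add: wspan_def)

lemma wspan_add: "p \<in> wspan N \<Longrightarrow> q \<in> wspan N \<Longrightarrow> p + q \<in> wspan N"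
  using Poly_Mapping.keys_add[of p q] unfolding wspan_def by blast

lemma wspan_scale: "p \<in> wspan N \<Longrightarrow> Poly_Mapping.single 0 c * p \<in> wspan N"
  using keys_scale[of c p] unfolding wspan_def by blast

lemma wspan_uminus: "p \<in> wspan N \<Longrightarrow> - p \<in> wspan N"
  by (simp add: wspan_def keys_minus)

lemma wspan_diff: "p \<in> wspan N \<Longrightarrow> q \<in> wspan N \<Longrightarrow> p - q \<in> wspan N"
  using wspan_add[of p N "- q"] by (simp add: wspan_uminus)

lemma wspan_sum: "(\<And>i. i \<in> S \<Longrightarrow> f i \<in> wspan N) \<Longrightarrow> sum f S \<in> wspan N"
  by (induction S rule: infinite_finite_induct) (auto simp: wspan_add)

lemma word_elt_in_wspan [simp]: "word_elt l \<in> wspan N \<longleftrightarrow> l \<in> N"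
  by (simp add: wspan_def)

lemma wspan_mono: "N \<subseteq> N' \<Longrightarrow> p \<in> wspan N \<Longrightarrow> p \<in> wspan N'"
  by (auto simp: wspan_def)

lemma klinear_wspan:
  assumes "klinear T" "0 \<in> V" "\<And>p q. p \<in> V \<Longrightarrow> q \<in> V \<Longrightarrow> p + q \<in> V"
    and "\<And>c p. p \<in> V \<Longrightarrow> Poly_Mapping.single 0 c * p \<in> V"
    and "\<And>l. l \<in> N \<Longrightarrow> T (word_elt l) \<in> V" and "p \<in> wspan N"
  shows "T p \<in> V"
proof (rule klinear_mem_span[OF assms(1-4)])
  fix w assume "w \<in> Poly_Mapping.keys p"
  then have "letters w \<in> N"
    using assms(6) by (simp add: wspan_def)
  from assms(5)[OF this] show "T (Poly_Mapping.single w 1) \<in> V" by simp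
qed

lemma klinear_wspan_zero:
  assumes "klinear T" "\<And>l. l \<in> N \<Longrightarrow> T (word_elt l) = 0" "p \<in> wspan N"
  shows "T p = 0"
  using klinear_wspan[of T "{0}" N p] assms by simp

lemma klinear_wspan_wspan:
  assumes "klinear T" "\<And>l. l \<in> N \<Longrightarrow> T (word_elt l) \<in> wspan N'" "p \<in> wspan N"
  shows "T p \<in> wspan N'"
  by (rule klinear_wspan[OF assms(1)]) (use assms in \<open>auto intro: wspan_add wspan_scale\<close>)

lemma free_algebra_carrier_eq_wspan:
  "carrier (free_algebra X) = wspan {l. l \<noteq> [] \<and> set l \<subseteq> X}"
  unfolding mem_free_algebra wspan_def set_eq_iff by simp

lemma klinear_id: "klinear (\<lambda>x. x)"
  by (simp add: klinear_def)

lemma klinear_diff_fun: "klinear S \<Longrightarrow> klinear T \<Longrightarrow> klinear (\<lambda>x. S x - T x)"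
  by (simp add: klinear_def algebra_simps)

lemma klinear_mult_right: "klinear (\<lambda>x. x * q)"
  by (simp add: klinear_def algebra_simps)

lemma klinear_mult_left: "klinear (\<lambda>x. q * x)"
proof -
  have "q * (Poly_Mapping.single 0 c * p) = Poly_Mapping.single 0 c * (q * p)" for c p
    by (metis mult.assoc single_central)
  then show ?thesis by (simp add: klinear_def algebra_simps)
qed

section \<open>The action on normal words\<close>

context lpa
begin

definition act_gen :: "('v, 'e) lpa_gen \<Rightarrow> (('v, 'e) lpa_gen word \<Rightarrow>\<^sub>0 'k::field) \<Rightarrow> ('v, 'e) lpa_gen word \<Rightarrow>\<^sub>0 'k" where
  "act_gen g = lin_ext (\<lambda>w. lact g (letters w))"

abbreviation act_word :: "('v, 'e) lpa_gen list \<Rightarrow> (('v, 'e) lpa_gen word \<Rightarrow>\<^sub>0 'k::field) \<Rightarrow> ('v, 'e) lpa_gen word \<Rightarrow>\<^sub>0 'k" where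
  "act_word \<equiv> foldr act_gen"

definition act :: "(('v, 'e) lpa_gen word \<Rightarrow>\<^sub>0 'k::field) \<Rightarrow> (('v, 'e) lpa_gen word \<Rightarrow>\<^sub>0 'k) \<Rightarrow> ('v, 'e) lpa_gen word \<Rightarrow>\<^sub>0 'k" where
  "act x n = lin_ext (\<lambda>w. act_word (letters w) n) x"

lemma klinear_act_gen: "klinear (act_gen g)"
  unfolding act_gen_def by (rule klinear_lin_ext)

lemma act_gen_word_elt [simp]: "act_gen g (word_elt l) = lact g l"
  by (simp add: act_gen_def)

lemma klinear_act_word: "klinear (act_word l)"
  by (induction l) (auto simp: klinear_id id_def comp_def intro: klinear_comp[OF klinear_act_gen])

lemma klinear_act_left: "klinear (\<lambda>x. act x n)"
  unfolding act_def by (rule klinear_lin_ext)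

lemma klinear_act: "klinear (act x)"
  unfolding act_def by (intro klinear_lin_ext_fun klinear_act_word)

lemma act_zeros [simp]: "act_gen g 0 = 0" "act x 0 = 0" "act 0 n = 0"
  by (rule klinear_zero klinear_act_gen klinear_act klinear_zero[OF klinear_act_left])+

lemma act_word_elt [simp]: "act (word_elt l) n = act_word l n"
  by (simp add: act_def)

lemma act_generator [simp]: "act (generator g) n = act_gen g n"
  by (simp add: generator_def)

lemma act_mult: "act (x * y) n = act x (act y n)"
proof -
  have *: "act (word_elt l * y) n = act_word l (act y n)" for l
  proof -
    have "klinear (\<lambda>y. act (word_elt l * y) n - act_word l (act y n))"
      by (intro klinear_diff_fun klinear_comp[OF klinear_act_word] klinear_act_left
          klinear_comp[OF klinear_act_left] klinear_mult_left)
    from klinear_wspan_zero[OF this, of UNIV y] show ?thesis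
      by (simp add: word_elt_mult wspan_def)
  qed
  have "klinear (\<lambda>x. act (x * y) n - act x (act y n))"
    by (intro klinear_diff_fun klinear_act_left klinear_comp[OF klinear_act_left] klinear_mult_right)
  from klinear_wspan_zero[OF this, of UNIV x] show ?thesis
    by (simp add: * wspan_def)
qed

lemma lact_in_wspan:
  assumes "l \<in> normal v" "g \<in> lpa_gens H"
  shows "lact g l \<in> wspan {l \<in> normal v. src (hd l) = src g}"
  using assms
proof (cases rule: lact_cases)
  case (forb c h i j l')
  have l': "l' \<noteq> []"
    using forb by auto
  have "\<not> forb (arc (\<not> c) h q j) (hd l')" if "0 < q" "q < deg (\<not> c) h" for q
    using assms(1) forb by (cases "hd l'" rule: lpa_gen_cases) auto
  then show ?thesis
    using forb l' assms by (auto simp: lact_forb intro!: wspan_diff wspan_uminus wspan_sum)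
qed (use assms in \<open>auto simp: lact_neq lact_Vertex lact_free intro: normal.arc\<close>)

abbreviation nspan :: "(('v, 'e) lpa_gen word \<Rightarrow>\<^sub>0 'k::field) set" where
  "nspan \<equiv> wspan (\<Union>v. normal v)"

lemma act_gen_in_wspan:
  assumes "n \<in> wspan (normal v)" "g \<in> lpa_gens H"
  shows "act_gen g n \<in> wspan {l \<in> normal v. src (hd l) = src g}"
  by (rule klinear_wspan_wspan[OF klinear_act_gen _ assms(1)]) (simp add: lact_in_wspan assms)

lemma act_gen_in_wspan_normal:
  assumes "n \<in> wspan (normal v)" "g \<in> lpa_gens H"
  shows "act_gen g n \<in> wspan (normal v)"
  by (rule wspan_mono[OF _ act_gen_in_wspan[OF assms]]) auto

lemma act_word_in_wspan_normal:
  "n \<in> wspan (normal v) \<Longrightarrow> set l \<subseteq> lpa_gens H \<Longrightarrow> act_word l n \<in> wspan (normal v)"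
  by (induction l) (auto intro: act_gen_in_wspan_normal)

lemma act_in_wspan_normal:
  assumes "n \<in> wspan (normal v)" "x \<in> carrier (free_algebra (lpa_gens H))"
  shows "act x n \<in> wspan (normal v)"
  by (rule klinear_wspan_wspan[OF klinear_act_left _ assms(2)[unfolded free_algebra_carrier_eq_wspan]])
    (use assms in \<open>simp add: act_word_in_wspan_normal\<close>)

lemma act_gen_in_nspan:
  assumes "n \<in> nspan" "g \<in> lpa_gens H"
  shows "act_gen g n \<in> nspan"
proof (rule klinear_wspan_wspan[OF klinear_act_gen _ assms(1)])
  fix l assume "l \<in> (\<Union>v. normal v)"
  then obtain v where "l \<in> normal v" by auto
  then have "lact g l \<in> wspan (normal v)"
    using act_gen_in_wspan_normal[of "word_elt l" v g] assms(2) by simp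
  then show "act_gen g (word_elt l) \<in> nspan"
    using wspan_mono[of "normal v" "\<Union>v. normal v"] by auto
qed

lemma act_word_in_nspan: "n \<in> nspan \<Longrightarrow> set l \<subseteq> lpa_gens H \<Longrightarrow> act_word l n \<in> nspan"
  by (induction l) (auto intro: act_gen_in_nspan)

lemma act_in_nspan:
  assumes "n \<in> nspan" "x \<in> carrier (free_algebra (lpa_gens H))"
  shows "act x n \<in> nspan"
  by (rule klinear_wspan_wspan[OF klinear_act_left _ assms(2)[unfolded free_algebra_carrier_eq_wspan]])
    (use assms in \<open>simp add: act_word_in_nspan\<close>)

lemma sum_lact_arc:
  assumes "h \<in> hedges H" "i < deg c h" "j < deg c h" "deg (\<not> c) h > 0"
  shows "(\<Sum>k<deg (\<not> c) h. lact (arc c h i k) (arc (\<not> c) h k j # l)) = (if i = j then word_elt l else 0)"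
proof -
  let ?m = "deg (\<not> c) h"
  let ?f = "\<lambda>k. lact (arc c h i k) (arc (\<not> c) h k j # l)"
  have "{..<?m} = insert 0 {1..<?m}"
    using assms(4) by auto
  then have "(\<Sum>k<?m. ?f k) = ?f 0 + (\<Sum>k = 1..<?m. ?f k)"
    by simp
  also have "(\<Sum>k = 1..<?m. ?f k) = (\<Sum>k = 1..<?m. word_elt (arc c h i k # arc (\<not> c) h k j # l))"
    using assms by (intro sum.cong lact_free) auto
  also have "?f 0 = (if i = j then word_elt l else 0)
      - (\<Sum>k = 1..<?m. word_elt (arc c h i k # arc (\<not> c) h k j # l))"
    by (rule lact_forb) simp
  finally show ?thesis by simp
qed

lemma sum_act_gen_arc_lact:
  assumes "h \<in> hedges H" "i < deg c h" "j < deg c h" "deg (\<not> c) h > 0" "l \<in> normal v"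
  shows "(\<Sum>k<deg (\<not> c) h. act_gen (arc c h i k) (lact (arc (\<not> c) h k j) l)) =
    (if i = j then lact (Vertex (side c h ! i)) l else (0 :: ('v, 'e) lpa_gen word \<Rightarrow>\<^sub>0 'k::field))"
proof -
  let ?m = "deg (\<not> c) h"
  obtain x l' where l: "l = x # l'"
    using assms(5) by (cases l) auto
  consider "src x \<noteq> side c h ! j"
    | t where "src x = side c h ! j" "j = 0" "x = arc c h 0 t"
    | "src x = side c h ! j" "\<And>k. \<not> forb (arc (\<not> c) h k j) x"
    by (cases x rule: lpa_gen_cases) auto
  then show ?thesis
  proof cases
    case 1
    then show ?thesis
      by (auto simp: l lact_neq)
  next
    case (2 t)
    define L where "L q = arc c h q t # l'" for q
    have t: "t < ?m" "side (\<not> c) h ! t = src (hd l')" "\<not> forb (arc c h i t) (hd l')" "l' \<noteq> []"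
      using assms(5) unfolding l 2
      by (cases "hd l'" rule: lpa_gen_cases; auto)+
    have "act_gen (arc c h i k) (lact (arc (\<not> c) h k j) l :: _ \<Rightarrow>\<^sub>0 'k) =
        (if k = t then lact (arc c h i k) l' else 0)
        - (\<Sum>q = 1..<deg c h. lact (arc c h i k) (arc (\<not> c) h k q # L q))" if "k < ?m" for k
    proof -
      have "lact (arc (\<not> c) h k j) l = (if k = t then word_elt l' else 0)
          - (\<Sum>q = 1..<deg c h. word_elt (arc (\<not> c) h k q # arc c h q t # l') :: _ \<Rightarrow>\<^sub>0 'k)"
        using lact_forb[of "\<not> c" h t k l'] 2 by (simp add: l)
      then show ?thesis
        by (simp only:)
          (simp add: l L_def klinear_diff[OF klinear_act_gen] klinear_sum[OF klinear_act_gen])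
    qed
    then have "(\<Sum>k<?m. act_gen (arc c h i k) (lact (arc (\<not> c) h k j) l :: _ \<Rightarrow>\<^sub>0 'k)) =
        (\<Sum>k<?m. if k = t then lact (arc c h i k) l' else 0)
        - (\<Sum>k<?m. \<Sum>q = 1..<deg c h. lact (arc c h i k) (arc (\<not> c) h k q # L q))"
      by (simp add: sum_subtractf)
    also have "(\<Sum>k<?m. if k = t then lact (arc c h i k) l' else 0) = lact (arc c h i t) l'"
      using t by simp
    also have "\<dots> = word_elt (L i)"
      using lact_free[of "arc c h i t" "hd l'" "tl l'"] t assms by (simp add: L_def)
    also have "(\<Sum>k<?m. \<Sum>q = 1..<deg c h. lact (arc c h i k) (arc (\<not> c) h k q # L q)) =
        (\<Sum>q = 1..<deg c h. if i = q then word_elt (L q) else 0)"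
      by (subst sum.swap) (use assms in \<open>simp add: sum_lact_arc\<close>)
    also have "\<dots> = (if 1 \<le> i then word_elt (L i) else 0)"
      using assms by simp
    finally show ?thesis
      using 2 by (simp add: l L_def lact_Vertex)
  next
    case 3
    have "lact (arc (\<not> c) h k j) l = (word_elt (arc (\<not> c) h k j # l) :: _ \<Rightarrow>\<^sub>0 'k)" if "k < ?m" for k
      unfolding l using 3 that assms by (intro lact_free) auto
    then have "(\<Sum>k<?m. act_gen (arc c h i k) (lact (arc (\<not> c) h k j) l :: _ \<Rightarrow>\<^sub>0 'k)) =
        (\<Sum>k<?m. lact (arc c h i k) (arc (\<not> c) h k j # l))"
      by simp
    also have "\<dots> = (if i = j then word_elt l else 0)"
      by (rule sum_lact_arc[OF assms(1-4)])
    finally show ?thesis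
      using 3 by (simp add: l lact_Vertex)
  qed
qed

end

section \<open>The ideal of relations acts trivially, and only it does\<close>

lemma word_elt_Cons: "word_elt (g # l) = generator g * word_elt l"
  by (simp add: generator_def word_elt_mult)

context lpa
begin

abbreviation free_alg :: "('k::field, ('v, 'e) lpa_gen word \<Rightarrow>\<^sub>0 'k) module" where
  "free_alg \<equiv> free_algebra (lpa_gens H)"

abbreviation rel_ideal :: "(('v, 'e) lpa_gen word \<Rightarrow>\<^sub>0 'k::field) set" where
  "rel_ideal \<equiv> generated_ideal free_alg (lpa_rels H sl rl)"

lemma gens_in_lpa_gens:
  assumes "h \<in> hedges H" "i < size (hsource H h)" "j < size (hrange H h)"
  shows "Edge h i j \<in> edge_gens H" "Ghost h i j \<in> edge_gens H"
  using assms by (auto simp: edge_gens_def)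

lemma lpa_rels_cases [consumes 1, case_names vertices source range arcs]:
  assumes "r \<in> lpa_rels H sl rl"
  obtains u v where "u \<in> hverts H" "v \<in> hverts H"
      "r = vertex_elt u * vertex_elt v - (if u = v then vertex_elt u else 0)"
  | a where "a \<in> edge_gens H" "r = vertex_elt (src a) * generator a - generator a"
  | a where "a \<in> edge_gens H" "r = generator a * vertex_elt (rng a) - generator a"
  | c h i j where "h \<in> hedges H" "i < deg c h" "j < deg c h"
      "r = (\<Sum>k<deg (\<not> c) h. generator (arc c h i k) * generator (arc (\<not> c) h k j))
        - (if i = j then vertex_elt (side c h ! i) else 0)"
  using assms
proof cases
  case (vertices u v)
  from vertices(2,3,1) show thesis by (rule that(1))
next
  case (source_edge h i j)
  with that(2)[of "Edge h i j"] show thesis by (simp add: gens_in_lpa_gens)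
next
  case (edge_range h i j)
  with that(3)[of "Edge h i j"] show thesis by (simp add: gens_in_lpa_gens)
next
  case (range_ghost h i j)
  with that(2)[of "Ghost h i j"] show thesis by (simp add: gens_in_lpa_gens)
next
  case (ghost_source h i j)
  with that(3)[of "Ghost h i j"] show thesis by (simp add: gens_in_lpa_gens)
next
  case (edge_ghost h i j)
  with that(4)[of h i True j] show thesis by (simp add: side_def arc_def size_sides)
next
  case (ghost_edge h i j)
  with that(4)[of h i False j] show thesis by (simp add: side_def arc_def size_sides)
qed

lemma lpa_rels_source: "a \<in> edge_gens H \<Longrightarrow> vertex_elt (src a) * generator a - generator a \<in> lpa_rels H sl rl"
  unfolding edge_gens_def by (auto intro: lpa_rels.source_edge lpa_rels.range_ghost)

lemma lpa_rels_range: "a \<in> edge_gens H \<Longrightarrow> generator a * vertex_elt (rng a) - generator a \<in> lpa_rels H sl rl"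
  unfolding edge_gens_def by (auto intro: lpa_rels.edge_range lpa_rels.ghost_source)

lemma lpa_rels_arcs:
  assumes "h \<in> hedges H" "i < deg c h" "j < deg c h"
  shows "(\<Sum>k<deg (\<not> c) h. generator (arc c h i k) * generator (arc (\<not> c) h k j))
    - (if i = j then vertex_elt (side c h ! i) else 0) \<in> lpa_rels H sl rl"
    (is "?r \<in> _")
proof (cases c)
  case True
  then have "?r = (\<Sum>k<size (hrange H h). edge_elt h i k * ghost_elt h j k)
      - (if i = j then vertex_elt (sl h ! i) else 0)"
    using assms by (simp add: arc_def side_def size_sides)
  also have "\<dots> \<in> lpa_rels H sl rl"
    using assms True by (intro lpa_rels.edge_ghost) (auto simp: side_def size_sides)
  finally show ?thesis .
next
  case False
  then have "?r = (\<Sum>k<size (hsource H h). ghost_elt h k i * edge_elt h k j)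
      - (if i = j then vertex_elt (rl h ! i) else 0)"
    using assms by (simp add: arc_def side_def size_sides)
  also have "\<dots> \<in> lpa_rels H sl rl"
    using assms False by (intro lpa_rels.ghost_edge) (auto simp: side_def size_sides)
  finally show ?thesis .
qed

lemma lpa_rels_subset: "lpa_rels H sl rl \<subseteq> carrier free_alg"
proof
  fix r :: "('v, 'e) lpa_gen word \<Rightarrow>\<^sub>0 'k::field" assume "r \<in> lpa_rels H sl rl"
  note mem = diff_in_free_algebra mult_in_free_algebra sum_in_free_algebra
    generator_in_free_algebra zero_in_free_algebra
  from \<open>r \<in> lpa_rels H sl rl\<close> show "r \<in> carrier free_alg"
  proof (cases rule: lpa_rels_cases)
    case (vertices u v)
    then show ?thesis by (simp add: mem)
  next
    case (source a)
    then have "a \<in> lpa_gens H" by (simp add: edge_gens_subset)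
    then show ?thesis
      using src_rng_in_hverts[of a] unfolding source(2) by (intro mem) auto
  next
    case (range a)
    then have "a \<in> lpa_gens H" by (simp add: edge_gens_subset)
    then show ?thesis
      using src_rng_in_hverts[of a] unfolding range(2) by (intro mem) auto
  next
    case (arcs c h i j)
    have "(\<Sum>k<deg (\<not> c) h. generator (arc c h i k) * generator (arc (\<not> c) h k j) :: _ \<Rightarrow>\<^sub>0 'k) \<in> carrier free_alg"
      using arcs by (intro mem) auto
    moreover have "(if i = j then vertex_elt (side c h ! i) else 0 :: _ \<Rightarrow>\<^sub>0 'k) \<in> carrier free_alg"
      using arcs side_in_hverts[of h j c] by (simp add: mem)
    ultimately show ?thesis
      unfolding arcs(4) by (rule diff_in_free_algebra)
  qed
qed

lemma algebra_ideal_rel_ideal: "algebra_ideal rel_ideal free_alg"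
  by (rule algebra_ideal_generated_ideal[OF lpa_rels_subset])

lemmas rel_ideal_zero [simp] = algebra_ideal_zero[OF algebra_ideal_rel_ideal]
  and rel_ideal_add = algebra_ideal_add[OF algebra_ideal_rel_ideal]
  and rel_ideal_scale = algebra_ideal_scale[OF algebra_ideal_rel_ideal]
  and rel_ideal_mult_left = algebra_ideal_mult_left[OF algebra_ideal_rel_ideal]
  and rel_ideal_mult_right = algebra_ideal_mult_right[OF algebra_ideal_rel_ideal]

lemma rel_ideal_uminus: "p \<in> rel_ideal \<Longrightarrow> - p \<in> rel_ideal"
  using rel_ideal_scale[of p "- 1"] by (simp add: single_uminus)

lemma rel_ideal_diff: "p \<in> rel_ideal \<Longrightarrow> q \<in> rel_ideal \<Longrightarrow> p - q \<in> rel_ideal"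
  using rel_ideal_add[of p "- q"] by (simp add: rel_ideal_uminus)

lemma lpa_rels_in_rel_ideal: "r \<in> lpa_rels H sl rl \<Longrightarrow> r \<in> rel_ideal"
  by (rule subsetD[OF generated_ideal_superset])

lemma gen_in_free_alg: "g \<in> lpa_gens H \<Longrightarrow> generator g \<in> carrier free_alg"
  by (rule generator_in_free_algebra)

lemma act_gen_Vertex_id:
  assumes "n \<in> wspan {l \<in> normal v. src (hd l) = w}"
  shows "act_gen (Vertex w) n = n"
proof -
  have lact_id: "lact (Vertex w) l = word_elt l" if "l \<in> normal v" "src (hd l) = w" for l
    using that by (cases l) (auto simp: lact_Vertex)
  have "act_gen (Vertex w) n - n = 0"
    by (rule klinear_wspan_zero[OF klinear_diff_fun[OF klinear_act_gen klinear_id] _ assms])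
      (simp add: lact_id)
  then show ?thesis by simp
qed

lemma sides_nonempty: "h \<in> hedges H \<Longrightarrow> deg c h > 0"
  using hsource[of h] hrange[of h] size_sides[of h] by (auto simp: side_def)

lemma act_lpa_rels:
  assumes "r \<in> lpa_rels H sl rl" "l \<in> normal v"
  shows "act r (word_elt l) = 0"
proof -
  obtain x l' where l: "l = x # l'"
    using assms(2) by (cases l) auto
  note diff = klinear_diff[OF klinear_act_left]
  from assms(1) show ?thesis
  proof (cases rule: lpa_rels_cases)
    case (vertices u w)
    then show ?thesis
      by (auto simp: diff act_mult l lact_Vertex)
  next
    case (source a)
    show ?thesis
      using source act_gen_Vertex_id[OF lact_in_wspan[OF assms(2) edge_gens_subset[OF source(1)]]]
      by (simp add: diff act_mult)
  next
    case (range a)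
    then show ?thesis
      by (cases "rng a = src x") (auto simp: diff act_mult l lact_Vertex lact_neq)
  next
    case (arcs c h i j)
    have "act r (word_elt l) =
        (\<Sum>k<deg (\<not> c) h. act_gen (arc c h i k) (lact (arc (\<not> c) h k j) l))
        - (if i = j then lact (Vertex (side c h ! i)) l else 0)"
      unfolding arcs(4) by (simp add: diff act_mult klinear_sum[OF klinear_act_left])
    then show ?thesis
      by (simp only: sum_act_gen_arc_lact[OF arcs(1-3) sides_nonempty[OF arcs(1)] assms(2)] diff_self)
  qed
qed

lemma act_rel_ideal:
  fixes x n :: "('v, 'e) lpa_gen word \<Rightarrow>\<^sub>0 'k::field"
  assumes "x \<in> rel_ideal" "n \<in> nspan"
  shows "act x n = 0"
proof -
  let ?K = "{x \<in> carrier free_alg. \<forall>n \<in> nspan. act x n = (0 :: _ \<Rightarrow>\<^sub>0 'k)}"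
  have "algebra_ideal ?K free_alg"
    by (rule algebra_ideal_free_algebraI)
      (auto simp: act_mult act_in_nspan zero_in_free_algebra klinear_add[OF klinear_act_left]
        klinear_scale[OF klinear_act_left]
        intro: add_in_free_algebra scale_in_free_algebra mult_in_free_algebra)
  moreover have "lpa_rels H sl rl \<subseteq> ?K"
  proof (intro subsetI CollectI conjI ballI)
    fix r :: "('v, 'e) lpa_gen word \<Rightarrow>\<^sub>0 'k" and n :: "('v, 'e) lpa_gen word \<Rightarrow>\<^sub>0 'k"
    assume r: "r \<in> lpa_rels H sl rl"
    then show "r \<in> carrier free_alg"
      using lpa_rels_subset by blast
    assume "n \<in> nspan"
    then show "act r n = 0"
      by (rule klinear_wspan_zero[OF klinear_act, rotated]) (use act_lpa_rels[OF r] in auto)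
  qed
  ultimately have "rel_ideal \<subseteq> ?K"
    by (rule generated_ideal_least)
  with assms show ?thesis by blast
qed

lemma rel_ideal_mult_word:
  assumes "z \<in> rel_ideal" "set l \<subseteq> lpa_gens H"
  shows "z * word_elt l \<in> rel_ideal"
  using assms by (cases "l = []") (auto simp: word_elt_Nil single_in_free_algebra rel_ideal_mult_right)

lemma rel_ideal_vertices:
  "u \<in> hverts H \<Longrightarrow> v \<in> hverts H \<Longrightarrow>
    vertex_elt u * vertex_elt v - (if u = v then vertex_elt u else 0) \<in> rel_ideal"
  by (intro lpa_rels_in_rel_ideal lpa_rels.vertices)

lemma rel_ideal_source:
  assumes "g \<in> lpa_gens H"
  shows "vertex_elt (src g) * generator g - generator g \<in> rel_ideal"
proof (cases g rule: lpa_gen_cases)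
  case (Vertex v)
  then show ?thesis
    using assms rel_ideal_vertices[of v v] by simp
next
  case (arc c h i k)
  then show ?thesis
    using assms by (intro lpa_rels_in_rel_ideal lpa_rels_source) simp
qed

lemma rel_ideal_range:
  assumes "g \<in> lpa_gens H"
  shows "generator g * vertex_elt (rng g) - generator g \<in> rel_ideal"
proof (cases g rule: lpa_gen_cases)
  case (Vertex v)
  then show ?thesis
    using assms rel_ideal_vertices[of v v] by simp
next
  case (arc c h i k)
  then show ?thesis
    using assms by (intro lpa_rels_in_rel_ideal lpa_rels_range) simp
qed

lemma rel_ideal_not_composable:
  assumes "g \<in> lpa_gens H" "x \<in> lpa_gens H" "rng g \<noteq> src x"
  shows "generator g * generator x \<in> (rel_ideal :: (('v, 'e) lpa_gen word \<Rightarrow>\<^sub>0 'k::field) set)"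
proof -
  define a b r s :: "('v, 'e) lpa_gen word \<Rightarrow>\<^sub>0 'k" where
    "a = generator g" and "b = generator x" and "r = vertex_elt (rng g)" and "s = vertex_elt (src x)"
  have carr: "a \<in> carrier free_alg" "b \<in> carrier free_alg" "a * r \<in> carrier free_alg"
    unfolding a_def b_def r_def using assms src_rng_in_hverts[OF assms(1)]
    by (auto intro!: mult_in_free_algebra gen_in_free_alg)
  have "r * s \<in> rel_ideal"
    using rel_ideal_vertices[of "rng g" "src x"] assms(3) src_rng_in_hverts[OF assms(1)]
      src_rng_in_hverts[OF assms(2)]
    by (simp add: r_def s_def)
  then have "a * (r * s) * b \<in> rel_ideal"
    by (rule rel_ideal_mult_right[OF rel_ideal_mult_left[OF _ carr(1)] carr(2)])
  moreover have "a * r * (s * b - b) \<in> rel_ideal"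
    unfolding s_def b_def by (rule rel_ideal_mult_left[OF rel_ideal_source[OF assms(2)] carr(3)])
  moreover have "(a * r - a) * b \<in> rel_ideal"
    unfolding a_def r_def by (rule rel_ideal_mult_right[OF rel_ideal_range[OF assms(1)] carr(2)])
  ultimately have "a * (r * s) * b - a * r * (s * b - b) - (a * r - a) * b \<in> rel_ideal"
    by (intro rel_ideal_diff)
  also have "a * (r * s) * b - a * r * (s * b - b) - (a * r - a) * b = a * b"
    by (simp add: algebra_simps)
  finally show ?thesis
    unfolding a_def b_def .
qed

lemma rel_ideal_source_word:
  assumes "set (x # l) \<subseteq> lpa_gens H"
  shows "vertex_elt (src x) * word_elt (x # l) - word_elt (x # l) \<in> rel_ideal"
  using rel_ideal_mult_word[OF rel_ideal_source[of x], of l] assms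
  by (simp add: word_elt_Cons algebra_simps)

lemma lact_cong:
  assumes "l \<in> normal v" "g \<in> lpa_gens H"
  shows "lact g l - generator g * word_elt l \<in> (rel_ideal :: (('v, 'e) lpa_gen word \<Rightarrow>\<^sub>0 'k::field) set)"
  using assms
proof (cases rule: lact_cases)
  case (neq x l')
  then have "generator g * generator x * word_elt l' \<in> rel_ideal"
    using assms normal_subset[OF assms(1)] by (intro rel_ideal_mult_word rel_ideal_not_composable) auto
  then show ?thesis
    using neq rel_ideal_uminus by (fastforce simp: lact_neq word_elt_Cons mult.assoc)
next
  case (Vertex x l')
  then show ?thesis
    using rel_ideal_uminus[OF rel_ideal_source_word[of x l']] normal_subset[OF assms(1)]
    by (simp add: lact_Vertex)
next
  case (free x l')
  then show ?thesis
    by (simp add: lact_free word_elt_Cons)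
next
  case (forb c h i j l')
  let ?m = "deg (\<not> c) h"
  let ?f = "\<lambda>k. generator (arc c h i k) * generator (arc (\<not> c) h k j) :: ('v, 'e) lpa_gen word \<Rightarrow>\<^sub>0 'k"
  let ?V = "if i = j then vertex_elt (side c h ! i) else 0 :: ('v, 'e) lpa_gen word \<Rightarrow>\<^sub>0 'k"
  let ?d = "if i = j then word_elt l' else 0 :: ('v, 'e) lpa_gen word \<Rightarrow>\<^sub>0 'k"
  have sub: "set l' \<subseteq> lpa_gens H"
    using normal_subset forb by blast
  have "((\<Sum>k<?m. ?f k) - ?V) * word_elt l' \<in> rel_ideal"
    using forb sub by (intro rel_ideal_mult_word lpa_rels_in_rel_ideal lpa_rels_arcs)
  moreover have "?V * word_elt l' - ?d \<in> rel_ideal"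
    using forb sub rel_ideal_source_word[of "hd l'" "tl l'"] by (cases l') auto
  ultimately have *: "- (((\<Sum>k<?m. ?f k) - ?V) * word_elt l' + (?V * word_elt l' - ?d)) \<in> rel_ideal"
    by (intro rel_ideal_uminus rel_ideal_add)
  have "{..<?m} = insert 0 {1..<?m}"
    using forb by auto
  then have sum: "(\<Sum>k<?m. ?f k) = ?f 0 + (\<Sum>k = 1..<?m. ?f k)"
    by simp
  have "lact g l = ?d - (\<Sum>k = 1..<?m. ?f k) * word_elt l'"
    unfolding forb(1,2) by (subst lact_forb) (simp_all add: word_elt_Cons sum_distrib_right mult.assoc)
  moreover have "generator g * word_elt l = ?f 0 * word_elt l'"
    unfolding forb(1,2) by (simp add: word_elt_Cons mult.assoc)
  ultimately have "lact g l - generator g * word_elt l =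
      - (((\<Sum>k<?m. ?f k) - ?V) * word_elt l' + (?V * word_elt l' - ?d))"
    unfolding sum by (simp only: distrib_right left_diff_distrib) simp
  with * show ?thesis by (simp only:)
qed

lemma act_gen_cong:
  assumes "n \<in> nspan" "g \<in> lpa_gens H"
  shows "act_gen g n - generator g * n \<in> rel_ideal"
  by (rule klinear_wspan[OF klinear_diff_fun[OF klinear_act_gen klinear_mult_left] _ _ _ _ assms(1)])
    (auto intro: rel_ideal_add rel_ideal_scale lact_cong assms(2))

lemma act_word_cong:
  assumes "n \<in> nspan" "set l \<subseteq> lpa_gens H"
  shows "act_word l n - word_elt l * n \<in> rel_ideal"
  using assms(2)
proof (induction l)
  case (Cons g l)
  have "act_gen g (act_word l n) - generator g * act_word l n \<in> rel_ideal"
    using Cons.prems assms(1) by (intro act_gen_cong act_word_in_nspan) auto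
  moreover have "generator g * (act_word l n - word_elt l * n) \<in> rel_ideal"
    using Cons by (intro rel_ideal_mult_left gen_in_free_alg) auto
  ultimately have "(act_gen g (act_word l n) - generator g * act_word l n)
      + generator g * (act_word l n - word_elt l * n) \<in> rel_ideal"
    by (rule rel_ideal_add)
  then show ?case
    by (simp add: word_elt_Cons algebra_simps)
qed (simp add: word_elt_Nil)

lemma act_cong:
  assumes "n \<in> nspan" "x \<in> carrier free_alg"
  shows "act x n - x * n \<in> rel_ideal"
  by (rule klinear_wspan[OF klinear_diff_fun[OF klinear_act_left klinear_mult_right] _ _ _ _
        assms(2)[unfolded free_algebra_carrier_eq_wspan]])
    (auto intro: rel_ideal_add rel_ideal_scale act_word_cong assms(1))

lemma vertex_elt_in_wspan: "v \<in> hverts H \<Longrightarrow> vertex_elt v \<in> wspan (normal v)"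
  by (simp add: generator_def normal.Vertex)

lemma wspan_normal_nspan: "n \<in> wspan (normal v) \<Longrightarrow> n \<in> nspan"
  by (erule wspan_mono[rotated]) auto

lemma rel_ideal_sum_vertices:
  fixes g defines "a \<equiv> generator g :: ('v, 'e) lpa_gen word \<Rightarrow>\<^sub>0 'k::field"
  assumes g: "g \<in> lpa_gens H" and "finite T" "T \<subseteq> hverts H"
  shows "(\<Sum>v\<in>T. a * vertex_elt v) - (if rng g \<in> T then a else 0) \<in> rel_ideal"
  using assms(3,4)
proof (induction T)
  case (insert v T)
  have "a * vertex_elt v - (if rng g = v then a else 0) \<in> rel_ideal"
  proof (cases "rng g = v")
    case True
    then show ?thesis using rel_ideal_range[OF g] by (simp add: a_def)
  next
    case False
    then show ?thesis
      using rel_ideal_not_composable[OF g, of "Vertex v"] insert.prems by (simp add: a_def)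
  qed
  moreover have "(\<Sum>v\<in>T. a * vertex_elt v) - (if rng g \<in> T then a else 0) \<in> rel_ideal"
    using insert by simp
  ultimately have "(a * vertex_elt v - (if rng g = v then a else 0))
      + ((\<Sum>v\<in>T. a * vertex_elt v) - (if rng g \<in> T then a else 0)) \<in> rel_ideal"
    by (rule rel_ideal_add)
  moreover have "(if rng g \<in> insert v T then a else 0) =
      (if rng g = v then a else 0) + (if rng g \<in> T then a else 0)"
    using insert.hyps by auto
  ultimately show ?case
    by (simp only: sum.insert[OF insert.hyps] add_diff_add)
qed simp

lemma act_faithful:
  fixes x :: "('v, 'e) lpa_gen word \<Rightarrow>\<^sub>0 'k::field"
  assumes x: "x \<in> carrier free_alg" and vanish: "\<And>v. v \<in> hverts H \<Longrightarrow> act x (vertex_elt v) = 0"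
  shows "x \<in> rel_ideal"
proof -
  let ?S = "(\<lambda>w. rng (last (letters w))) ` Poly_Mapping.keys x"
  let ?e = "\<Sum>v\<in>?S. vertex_elt v :: ('v, 'e) lpa_gen word \<Rightarrow>\<^sub>0 'k"
  have S: "?S \<subseteq> hverts H"
  proof
    fix v assume "v \<in> ?S"
    then obtain w where "w \<in> Poly_Mapping.keys x" "v = rng (last (letters w))"
      by auto
    then have "last (letters w) \<in> lpa_gens H"
      using x last_in_set[of "letters w"] unfolding mem_free_algebra by blast
    with \<open>v = rng (last (letters w))\<close> show "v \<in> hverts H"
      using src_rng_in_hverts by simp
  qed
  have "x * vertex_elt v \<in> rel_ideal" if "v \<in> hverts H" for v
    using rel_ideal_uminus[OF act_cong[OF wspan_normal_nspan[OF vertex_elt_in_wspan[OF that]] x]]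
    by (simp add: vanish that)
  then have "(\<Sum>v\<in>T. x * vertex_elt v) \<in> rel_ideal" if "T \<subseteq> hverts H" for T
    using that by (induction T rule: infinite_finite_induct) (auto intro: rel_ideal_add)
  then have xe: "x * ?e \<in> rel_ideal"
    using S by (simp add: sum_distrib_left)
  have "word_elt l * ?e - word_elt l \<in> rel_ideal"
    if l: "l \<noteq> []" "set l \<subseteq> lpa_gens H" "rng (last l) \<in> ?S" for l
  proof -
    let ?g = "last l"
    let ?a = "word_elt (butlast l) :: ('v, 'e) lpa_gen word \<Rightarrow>\<^sub>0 'k"
    have g: "?g \<in> lpa_gens H"
      using l last_in_set by blast
    have ge: "generator ?g * ?e - generator ?g \<in> rel_ideal"
      using rel_ideal_sum_vertices[OF g _ S] l(3) by (simp add: sum_distrib_left)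
    have "?a * (generator ?g * ?e - generator ?g) \<in> rel_ideal"
    proof (cases "butlast l = []")
      case False
      then show ?thesis
        using l(2) in_set_butlastD[of _ l] ge
        by (intro rel_ideal_mult_left single_in_free_algebra) auto
    qed (use ge in \<open>simp add: word_elt_Nil\<close>)
    moreover have "word_elt l = ?a * generator ?g"
      using l(1) by (simp add: generator_def word_elt_mult)
    ultimately show ?thesis
      by (simp add: algebra_simps)
  qed
  then have letters: "word_elt l * ?e - word_elt l \<in> rel_ideal" if "l \<in> letters ` Poly_Mapping.keys x" for l
    using that x unfolding mem_free_algebra by blast
  have "x \<in> wspan (letters ` Poly_Mapping.keys x)"
    by (simp add: wspan_def)
  then have "x * ?e - x \<in> rel_ideal"
    by (rule klinear_wspan[OF klinear_diff_fun[OF klinear_mult_right klinear_id], rotated -1])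
      (simp_all add: rel_ideal_add rel_ideal_scale letters)
  from rel_ideal_diff[OF xe this] show ?thesis by simp
qed

end

section \<open>Leading terms\<close>

lemma lookup_wspan: "z \<in> wspan N \<Longrightarrow> l \<notin> N \<Longrightarrow> Poly_Mapping.lookup z (Word l) = 0"
proof (rule ccontr)
  assume "z \<in> wspan N" "l \<notin> N" "Poly_Mapping.lookup z (Word l) \<noteq> 0"
  then have "letters (Word l) \<in> N"
    unfolding wspan_def by (simp add: in_keys_iff del: word.sel)
  with \<open>l \<notin> N\<close> show False by simp
qed

lemma lookup_word_elt: "Poly_Mapping.lookup (word_elt l) (Word m) = (if l = m then 1 else 0)"
  by (simp add: lookup_single when_def)

lemma sum_sum_delta:
  fixes f g :: "_ \<Rightarrow> 'k::field"
  assumes "finite A" "finite B"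
  shows "(\<Sum>q\<in>A. \<Sum>p\<in>B. f q * (g p * (if q = Q \<and> p = P then 1 else 0))) =
    (if Q \<in> A \<and> P \<in> B then f Q * g P else 0)"
proof -
  have "(\<Sum>p\<in>B. f q * (g p * (if q = Q \<and> p = P then 1 else 0))) =
      (if q = Q then if P \<in> B then f Q * g P else 0 else 0)" for q
  proof (cases "q = Q")
    case True
    have "(\<Sum>p\<in>B. f q * (g p * (if q = Q \<and> p = P then 1 else 0))) = (\<Sum>p\<in>B. if p = P then f Q * g P else 0)"
      by (intro sum.cong) (auto simp: True)
    then show ?thesis using assms True by simp
  qed simp
  then have "(\<Sum>q\<in>A. \<Sum>p\<in>B. f q * (g p * (if q = Q \<and> p = P then 1 else 0))) =
      (\<Sum>q\<in>A. if q = Q then if P \<in> B then f Q * g P else 0 else 0)"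
    by (rule sum.cong[OF refl])
  then show ?thesis using assms by simp
qed

context lpa
begin

lemma normal_ConsD:
  assumes "a # l \<in> normal v" "l \<noteq> []"
  shows "l \<in> normal v" "a \<in> edge_gens H" "rng a = src (hd l)" "\<not> forb a (hd l)"
proof -
  have "l \<in> normal v \<and> a \<in> edge_gens H \<and> rng a = src (hd l) \<and> \<not> forb a (hd l)"
    using assms(1) by cases (use assms(2) in simp_all)
  then show "l \<in> normal v" "a \<in> edge_gens H" "rng a = src (hd l)" "\<not> forb a (hd l)" by auto
qed

lemma lact_in_wspan_length: "lact g l \<in> wspan {m. length m \<le> Suc (length l)}"
proof (cases l)
  case (Cons x l')
  then show ?thesis
    by (cases g; cases x) (auto simp: lact.simps intro!: wspan_diff wspan_uminus wspan_sum)
qed simp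

lemma act_gen_in_wspan_length:
  assumes "z \<in> wspan {l. length l < n}"
  shows "act_gen g z \<in> wspan {l. length l < Suc n}"
  by (rule klinear_wspan_wspan[OF klinear_act_gen _ assms])
    (auto intro!: wspan_mono[OF _ lact_in_wspan_length])

lemma lact_Vertex_id: "p \<in> normal u \<Longrightarrow> src (hd p) = v \<Longrightarrow> lact (Vertex v) p = word_elt p"
  by (cases p) (auto simp: lact_Vertex)

lemma act_word_free:
  assumes "as @ [Vertex v] \<in> normal v" "p \<in> normal u" "src (hd p) = v"
    and "as = [] \<or> \<not> forb (last as) (hd p)"
  shows "act_word as (word_elt p) = (word_elt (as @ p) :: _ \<Rightarrow>\<^sub>0 'k::field)"
  using assms(1,4)
proof (induction as)
  case (Cons a as)
  obtain x p' where p: "p = x # p'"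
    using assms(2) by (cases p) auto
  note a = normal_ConsD[of a "as @ [Vertex v]" v]
  show ?case
  proof (cases as)
    case Nil
    then have "lact a p = word_elt (a # p)"
      using Cons.prems assms(3) a unfolding p by (intro lact_free) auto
    then show ?thesis using Nil by simp
  next
    case (Cons b bs)
    then have "act_word as (word_elt p) = (word_elt (as @ p) :: _ \<Rightarrow>\<^sub>0 'k)"
      using Cons.IH Cons.prems a by auto
    moreover have "lact a (as @ p) = word_elt (a # as @ p)"
      using Cons Cons.prems a by (auto intro!: lact_free)
    ultimately show ?thesis by simp
  qed
qed simp

lemma act_word_forb:
  fixes p :: "('v, 'e) lpa_gen list"
  assumes "as @ [arc c h i 0, Vertex v] \<in> normal v"
  shows "act_word (as @ [arc c h i 0]) (word_elt (arc (\<not> c) h 0 j # p))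
      + (\<Sum>k = 1..<deg (\<not> c) h. word_elt (as @ arc c h i k # arc (\<not> c) h k j # p))
    \<in> (wspan {l. length l < length as + length p + 2} :: (_ \<Rightarrow>\<^sub>0 'k::field) set)"
  using assms
proof (induction as)
  case Nil
  then show ?case by (auto simp: lact_forb)
next
  case (Cons a as)
  let ?A = "act_word (as @ [arc c h i 0]) (word_elt (arc (\<not> c) h 0 j # p)) :: _ \<Rightarrow>\<^sub>0 'k"
  let ?w = "\<lambda>k. as @ arc c h i k # arc (\<not> c) h k j # p"
  note a = normal_ConsD[of a "as @ [arc c h i 0, Vertex v]" v]
  have lact_w: "lact a (?w k) = word_elt (a # ?w k)" if "k < deg (\<not> c) h" for k
  proof (cases as)
    case Nil
    then show ?thesis
      using Cons.prems a by (cases a rule: lpa_gen_cases) (auto intro!: lact_free)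
  next
    case (Cons b bs)
    then show ?thesis
      using Cons.prems a by (auto intro!: lact_free)
  qed
  have "act_gen a (?A + (\<Sum>k = 1..<deg (\<not> c) h. word_elt (?w k))) =
      act_word ((a # as) @ [arc c h i 0]) (word_elt (arc (\<not> c) h 0 j # p))
      + (\<Sum>k = 1..<deg (\<not> c) h. word_elt (a # ?w k))"
    by (simp add: klinear_add[OF klinear_act_gen] klinear_sum[OF klinear_act_gen] lact_w)
  moreover have "act_gen a (?A + (\<Sum>k = 1..<deg (\<not> c) h. word_elt (?w k)))
      \<in> wspan {l. length l < Suc (length as + length p + 2)}"
    using Cons a by (intro act_gen_in_wspan_length) auto
  ultimately show ?case by simp
qed

lemma act_word_in_wspan_length:
  "z \<in> wspan {l. length l < n} \<Longrightarrow> act_word as z \<in> wspan {l. length l < length as + n}"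
  by (induction as) (auto dest: act_gen_in_wspan_length)

text \<open>
  Two words are parallel if the last arc of the first one and the first arc of the second one
  occur together as a summand in the left-hand side of a relation.
\<close>

definition parallel :: "('v, 'e) lpa_gen list \<Rightarrow> ('v, 'e) lpa_gen list \<Rightarrow> bool" where
  "parallel as p \<longleftrightarrow> (\<exists>as' c h i k j p'. as = as' @ [arc c h i k] \<and> p = arc (\<not> c) h k j # p')"

lemma parallel_snoc_Cons [simp]:
  "parallel (as @ [arc c h i k]) (arc c' h' k' j # p) \<longleftrightarrow> c' = (\<not> c) \<and> h' = h \<and> k' = k"
  by (auto simp: parallel_def)

lemma lookup_act_word_less:
  assumes "length as + length p < length z" "src (hd p) = v" "p \<in> normal u"
  shows "Poly_Mapping.lookup (act_word (as @ [Vertex v]) (word_elt p)) (Word z) = 0"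
  using assms(1)
  by (auto simp: lact_Vertex_id[OF assms(3,2)]
      intro!: lookup_wspan[OF act_word_in_wspan_length[of _ "Suc (length p)"]])

lemma lookup_act_word_free:
  assumes "as @ [Vertex v] \<in> normal v" "p \<in> normal u" "src (hd p) = v"
    and "as = [] \<or> \<not> forb (last as) (hd p)"
  shows "Poly_Mapping.lookup (act_word (as @ [Vertex v]) (word_elt p)) (Word z) = (if as @ p = z then 1 else 0)"
  by (simp add: lact_Vertex_id[OF assms(2,3)] act_word_free[OF assms] lookup_word_elt)

lemma lookup_act_word_forb:
  assumes "as @ [arc c h i 0, Vertex v] \<in> normal v" "arc (\<not> c) h 0 j # p \<in> normal u" "side (\<not> c) h ! 0 = v"
    and "length as + length p + 2 \<le> length z"
  shows "Poly_Mapping.lookup (act_word (as @ [arc c h i 0, Vertex v]) (word_elt (arc (\<not> c) h 0 j # p))) (Word z) =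
    (if \<exists>k \<in> {1..<deg (\<not> c) h}. z = as @ arc c h i k # arc (\<not> c) h k j # p then - 1 else (0 :: 'k::field))"
    (is "Poly_Mapping.lookup ?A _ = _")
proof -
  let ?w = "\<lambda>k. as @ arc c h i k # arc (\<not> c) h k j # p"
  have "?A = act_word (as @ [arc c h i 0]) (word_elt (arc (\<not> c) h 0 j # p))"
    using assms(3) by (simp add: lact_Vertex)
  then have "?A + (\<Sum>k = 1..<deg (\<not> c) h. word_elt (?w k)) \<in> wspan {l. length l < length as + length p + 2}"
    using act_word_forb[OF assms(1)] by simp
  then have "Poly_Mapping.lookup (?A + (\<Sum>k = 1..<deg (\<not> c) h. word_elt (?w k))) (Word z) = 0"
    using assms(4) by (intro lookup_wspan) auto
  then have "Poly_Mapping.lookup ?A (Word z) =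
      - (\<Sum>k = 1..<deg (\<not> c) h. if ?w k = z then 1 else 0)"
    by (simp add: lookup_add lookup_sum lookup_word_elt eq_neg_iff_add_eq_0)
  moreover have "(\<Sum>k = 1..<deg (\<not> c) h. if ?w k = z then 1 else 0) =
      (if \<exists>k \<in> {1..<deg (\<not> c) h}. z = ?w k then 1 else (0 :: 'k))"
  proof (cases "\<exists>k \<in> {1..<deg (\<not> c) h}. z = ?w k")
    case True
    then obtain k where k: "k \<in> {1..<deg (\<not> c) h}" "z = ?w k" by blast
    then have "(\<Sum>q = 1..<deg (\<not> c) h. if ?w q = z then 1 else 0) =
        (\<Sum>q = 1..<deg (\<not> c) h. if q = k then 1 else (0 :: 'k))"
      by (intro sum.cong) auto
    with k True show ?thesis by simp
  qed (auto intro!: sum.neutral)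
  ultimately show ?thesis by simp
qed

lemma lookup_act:
  "Poly_Mapping.lookup (act y n) z = (\<Sum>q\<in>Poly_Mapping.keys y. \<Sum>p\<in>Poly_Mapping.keys n.
    Poly_Mapping.lookup y q * (Poly_Mapping.lookup n p *
      Poly_Mapping.lookup (act_word (letters q) (word_elt (letters p))) z))"
proof -
  have "act y n = (\<Sum>q\<in>Poly_Mapping.keys y. Poly_Mapping.single 0 (Poly_Mapping.lookup y q) *
      act_word (letters q) n)"
    by (simp add: act_def lin_ext_def)
  moreover have "act_word (letters q) n = (\<Sum>p\<in>Poly_Mapping.keys n.
      Poly_Mapping.single 0 (Poly_Mapping.lookup n p) * act_word (letters q) (word_elt (letters p)))" for q
    using klinear_expand[OF klinear_act_word] by simp
  ultimately show ?thesis
    by (simp add: lookup_sum lookup_scale sum_distrib_left)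
qed

context
  fixes y n :: "('v, 'e) lpa_gen word \<Rightarrow>\<^sub>0 'k::field" and u v :: 'v and D E :: nat
  assumes y: "y \<in> wspan (normal v)" and n: "n \<in> wspan {l \<in> normal u. src (hd l) = v}"
    and E: "\<And>q. q \<in> Poly_Mapping.keys y \<Longrightarrow> length (letters q) \<le> Suc E"
    and D: "\<And>p. p \<in> Poly_Mapping.keys n \<Longrightarrow> length (letters p) \<le> D"
begin

private definition b where "b as = Poly_Mapping.lookup y (Word (as @ [Vertex v]))"
private definition a where "a p = Poly_Mapping.lookup n (Word p)"

private lemma lookup_act_eq:
  assumes t: "\<And>as p. \<lbrakk>as @ [Vertex v] \<in> normal v; p \<in> normal u; src (hd p) = v; length as \<le> E; length p \<le> D\<rbrakk>
      \<Longrightarrow> Poly_Mapping.lookup (act_word (as @ [Vertex v]) (word_elt p)) (Word z) = t as p"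
  shows "Poly_Mapping.lookup (act y n) (Word z) = (\<Sum>q\<in>Poly_Mapping.keys y. \<Sum>p\<in>Poly_Mapping.keys n.
    Poly_Mapping.lookup y q * (Poly_Mapping.lookup n p * t (butlast (letters q)) (letters p)))"
  unfolding lookup_act
proof (intro sum.cong refl)
  fix q p assume q: "q \<in> Poly_Mapping.keys y" and p: "p \<in> Poly_Mapping.keys n"
  then have "letters q \<in> normal v" and p': "letters p \<in> normal u" "src (hd (letters p)) = v"
    using y n by (auto simp: wspan_def)
  then obtain as where as: "letters q = as @ [Vertex v]"
    using normal_last[of "letters q" v] by (metis append_butlast_last_id normal_not_Nil)
  then have "Poly_Mapping.lookup (act_word (letters q) (word_elt (letters p))) (Word z) = t as (letters p)"
    using t[of as "letters p"] E[OF q] D[OF p] p' \<open>letters q \<in> normal v\<close> by simp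
  then show "Poly_Mapping.lookup y q * (Poly_Mapping.lookup n p *
      Poly_Mapping.lookup (act_word (letters q) (word_elt (letters p))) (Word z)) =
    Poly_Mapping.lookup y q * (Poly_Mapping.lookup n p * t (butlast (letters q)) (letters p))"
    by (simp add: as)
qed

private lemma sum_keys_delta:
  "(\<Sum>q\<in>Poly_Mapping.keys y. \<Sum>p\<in>Poly_Mapping.keys n.
    Poly_Mapping.lookup y q * (Poly_Mapping.lookup n p *
      (if butlast (letters q) = as \<and> letters p = l then 1 else 0))) = b as * a l"
proof -
  have "(\<Sum>q\<in>Poly_Mapping.keys y. \<Sum>p\<in>Poly_Mapping.keys n.
      Poly_Mapping.lookup y q * (Poly_Mapping.lookup n p *
        (if butlast (letters q) = as \<and> letters p = l then 1 else 0))) =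
    (\<Sum>q\<in>Poly_Mapping.keys y. \<Sum>p\<in>Poly_Mapping.keys n.
      Poly_Mapping.lookup y q * (Poly_Mapping.lookup n p *
        (if q = Word (as @ [Vertex v]) \<and> p = Word l then 1 else 0)))"
  proof (intro sum.cong refl)
    fix q p assume q: "q \<in> Poly_Mapping.keys y"
    then have "letters q \<in> normal v"
      using y by (auto simp: wspan_def)
    then have "butlast (letters q) @ [Vertex v] = letters q"
      using normal_last[of "letters q" v] by (metis append_butlast_last_id normal_not_Nil)
    then have "butlast (letters q) = as \<longleftrightarrow> q = Word (as @ [Vertex v])"
      by (cases q) auto
    moreover have "letters p = l \<longleftrightarrow> p = Word l"
      by (cases p) auto
    ultimately show "Poly_Mapping.lookup y q * (Poly_Mapping.lookup n p *
        (if butlast (letters q) = as \<and> letters p = l then 1 else 0)) =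
      Poly_Mapping.lookup y q * (Poly_Mapping.lookup n p *
        (if q = Word (as @ [Vertex v]) \<and> p = Word l then 1 else 0))"
      by simp
  qed
  also have "\<dots> = b as * a l"
    by (subst sum_sum_delta) (auto simp: b_def a_def in_keys_iff)
  finally show ?thesis .
qed

private lemma lookup_act_word_top:
  assumes len: "length as = E" "length l = D"
    and reduced: "\<And>as'' c h i j p'. as = as'' @ [arc c h i 0] \<Longrightarrow> l \<noteq> arc (\<not> c) h 0 j # p'"
    and P_overlap: "\<And>as' p. P as' p \<Longrightarrow> \<exists>as'' c h i j p'. as' = as'' @ [arc c h i 0] \<and> p = arc (\<not> c) h 0 j # p'"
    and P_iff: "\<And>as'' c h i j p'. P (as'' @ [arc c h i 0]) (arc (\<not> c) h 0 j # p') \<longleftrightarrow>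
      (\<exists>k \<in> {1..<deg (\<not> c) h}. as = as'' @ [arc c h i k] \<and> l = arc (\<not> c) h k j # p')"
    and as': "as' @ [Vertex v] \<in> normal v" "length as' \<le> E"
    and p: "p \<in> normal u" "src (hd p) = v" "length p \<le> D"
  shows "Poly_Mapping.lookup (act_word (as' @ [Vertex v]) (word_elt p)) (Word (as @ l)) =
    (if as' = as \<and> p = l then 1 else 0) - (if P as' p then 1 else (0 :: 'k))"
proof -
  consider "length as' + length p < length (as @ l)"
    | "length as' = length as" "length p = length l" "as' = [] \<or> \<not> forb (last as') (hd p)"
    | c h i j as'' p' where "length as' = length as" "length p = length l"
      "as' = as'' @ [arc c h i 0]" "p = arc (\<not> c) h 0 j # p'"
  proof -
    have "length as' = length as \<and> length p = length l" if "\<not> length as' + length p < length (as @ l)"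
      using that as' p len by auto
    moreover have "\<exists>c h i j as'' p'. as' = as'' @ [arc c h i 0] \<and> p = arc (\<not> c) h 0 j # p'"
      if "as' \<noteq> []" "forb (last as') (hd p)"
      using that p(1) unfolding forb_def
      by (metis append_butlast_last_id list.collapse normal_not_Nil)
    ultimately show thesis using that by metis
  qed
  then show ?thesis
  proof cases
    case 1
    have "\<not> P as' p"
    proof
      assume "P as' p"
      moreover from this obtain as'' c h i j p'
        where eq: "as' = as'' @ [arc c h i 0]" "p = arc (\<not> c) h 0 j # p'"
        using P_overlap by blast
      ultimately obtain k where "as = as'' @ [arc c h i k]" "l = arc (\<not> c) h k j # p'"
        using P_iff by blast
      with 1 eq show False by simp
    qed
    moreover have "\<not> (as' = as \<and> p = l)"
      using 1 by auto
    ultimately show ?thesis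
      using 1 p by (subst lookup_act_word_less[where u = u]) auto
  next
    case 2
    have "\<not> P as' p"
      using P_overlap[of as' p] 2(3) by fastforce
    then show ?thesis
      using 2 as' p by (subst lookup_act_word_free[where u = u]) auto
  next
    case (3 c h i j as'' p')
    have "side (\<not> c) h ! 0 = v"
      using p(2) 3 by simp
    moreover have "\<not> (as' = as \<and> p = l)"
      using reduced 3 by blast
    moreover have "as @ l = as'' @ arc c h i k # arc (\<not> c) h k j # p' \<longleftrightarrow>
        as = as'' @ [arc c h i k] \<and> l = arc (\<not> c) h k j # p'" for k
      using append_eq_append_conv[of as "as'' @ [arc c h i k]" l "arc (\<not> c) h k j # p'"] 3 by simp
    moreover have "Poly_Mapping.lookup (act_word (as'' @ [arc c h i 0, Vertex v])
        (word_elt (arc (\<not> c) h 0 j # p'))) (Word (as @ l)) =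
      (if \<exists>k \<in> {1..<deg (\<not> c) h}. as @ l = as'' @ arc c h i k # arc (\<not> c) h k j # p' then - 1 else (0 :: 'k))"
      using as' p 3 \<open>side (\<not> c) h ! 0 = v\<close> by (intro lookup_act_word_forb) auto
    ultimately show ?thesis
      using P_iff[of as'' c h i j p'] 3 by (simp only: append_assoc append.simps) simp
  qed
qed

private lemma lookup_act_not_parallel:
  assumes "length as = E" "length l = D" "\<not> parallel as l"
  shows "Poly_Mapping.lookup (act y n) (Word (as @ l)) = b as * a l"
proof -
  have not_parallel: "\<not> (as = as'' @ [arc c h i k] \<and> l = arc (\<not> c) h k j # p')" for as'' c h i j k p'
    using assms(3) by auto
  have "Poly_Mapping.lookup (act_word (as' @ [Vertex v]) (word_elt p)) (Word (as @ l)) =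
      (if as' = as \<and> p = l then 1 else (0 :: 'k))"
    if "as' @ [Vertex v] \<in> normal v" "p \<in> normal u" "src (hd p) = v" "length as' \<le> E" "length p \<le> D" for as' p
    using lookup_act_word_top[OF assms(1,2), of "\<lambda>_ _. False" as' p] that not_parallel by fastforce
  from lookup_act_eq[of "as @ l", OF this] show ?thesis
    by (simp only: sum_keys_delta)
qed

private lemma lookup_act_parallel:
  assumes "length (as @ [arc c h i k]) = E" "length (arc (\<not> c) h k j # l) = D" "k \<in> {1..<deg (\<not> c) h}"
  shows "Poly_Mapping.lookup (act y n) (Word ((as @ [arc c h i k]) @ arc (\<not> c) h k j # l)) =
    b (as @ [arc c h i k]) * a (arc (\<not> c) h k j # l) - b (as @ [arc c h i 0]) * a (arc (\<not> c) h 0 j # l)"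
proof -
  define P where "P = (\<lambda>as' p. as' = as @ [arc c h i 0] \<and> p = arc (\<not> c) h 0 j # l)"
  have "Poly_Mapping.lookup (act_word (as' @ [Vertex v]) (word_elt p)) (Word ((as @ [arc c h i k]) @ arc (\<not> c) h k j # l)) =
      (if as' = as @ [arc c h i k] \<and> p = arc (\<not> c) h k j # l then 1 else 0) - (if P as' p then 1 else (0 :: 'k))"
    if "as' @ [Vertex v] \<in> normal v" "p \<in> normal u" "src (hd p) = v" "length as' \<le> E" "length p \<le> D" for as' p
    using that assms(3) by (intro lookup_act_word_top[OF assms(1,2)]) (auto simp: P_def)
  from lookup_act_eq[of "(as @ [arc c h i k]) @ arc (\<not> c) h k j # l", OF this] show ?thesis
    unfolding P_def by (simp only: right_diff_distrib sum_subtractf sum_keys_delta)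
qed

text \<open>
  For a fixed edge the coefficients of \<open>y\<close> and \<open>n\<close> on top-degree words form vectors \<open>\<beta>\<close> and
  \<open>\<alpha>\<close> indexed by \<open>k\<close>. If \<open>act y n\<close> has no component of top degree, then the rank-one matrix
  \<open>\<beta>\<^sub>k \<alpha>\<^sub>l\<close> is a scalar multiple of the identity of size at least two, hence zero.
\<close>

lemma act_nonzero_of_top:
  assumes two: "\<And>c h. h \<in> hedges H \<Longrightarrow> 2 \<le> deg c h"
    and as_top: "length as = E" "Poly_Mapping.lookup y (Word (as @ [Vertex v])) \<noteq> 0"
    and l_top: "length l = D" "Poly_Mapping.lookup n (Word l) \<noteq> 0"
  shows "act y n \<noteq> 0"
proof
  note as = as_top[folded b_def] and l = l_top[folded a_def]
  assume zero: "act y n = 0"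
  have "parallel as l"
    using lookup_act_not_parallel[of as l] zero as l by auto
  then obtain as' c h i k j l' where eq: "as = as' @ [arc c h i k]" "l = arc (\<not> c) h k j # l'"
    by (auto simp: parallel_def)
  define \<beta> where "\<beta> q = b (as' @ [arc c h i q])" for q
  define \<alpha> where "\<alpha> q = a (arc (\<not> c) h q j # l')" for q
  have "Word l \<in> Poly_Mapping.keys n"
    using l by (simp add: a_def in_keys_iff)
  then have "l \<in> normal u"
    using n by (auto simp: wspan_def)
  then have k: "h \<in> hedges H" "k < deg (\<not> c) h"
    by (auto simp: eq)
  have equal: "\<beta> q * \<alpha> q = \<beta> 0 * \<alpha> 0" if "q < deg (\<not> c) h" for q
  proof (cases "q = 0")
    case False
    then show ?thesis
      using lookup_act_parallel[of as' c h i q j l'] zero as(1) l(1) eq that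
      by (simp add: \<alpha>_def \<beta>_def)
  qed simp
  have off_diagonal: "\<beta> q * \<alpha> r = 0" if "q \<noteq> r" for q r
    using lookup_act_not_parallel[of "as' @ [arc c h i q]" "arc (\<not> c) h r j # l'"] zero as(1) l(1) eq that
    by (simp add: \<alpha>_def \<beta>_def)
  obtain q where q: "q < deg (\<not> c) h" "q \<noteq> k"
    using two[OF k(1), of "\<not> c"] by (metis Suc_1 Suc_le_lessD less_trans zero_less_Suc zero_neq_one One_nat_def)
  have "\<beta> k * \<alpha> k \<noteq> 0"
    using as(2) l(2) by (simp add: \<alpha>_def \<beta>_def eq)
  moreover have "\<beta> q * \<alpha> q = \<beta> k * \<alpha> k"
    using equal[OF q(1)] equal[OF k(2)] by simp
  ultimately show False
    using off_diagonal[OF q(2)] by auto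
qed

end

lemma act_normal_nonzero:
  fixes y n :: "('v, 'e) lpa_gen word \<Rightarrow>\<^sub>0 'k::field"
  assumes two: "\<And>c h. h \<in> hedges H \<Longrightarrow> 2 \<le> deg c h"
    and y: "y \<in> wspan (normal v)" "y \<noteq> 0"
    and n: "n \<in> wspan {l \<in> normal u. src (hd l) = v}" "n \<noteq> 0"
  shows "act y n \<noteq> 0"
proof -
  have arg_max: "\<exists>w \<in> Poly_Mapping.keys p. \<forall>w' \<in> Poly_Mapping.keys p. length (letters w') \<le> length (letters w)"
    if "p \<noteq> 0" for p :: "('v, 'e) lpa_gen word \<Rightarrow>\<^sub>0 'k"
  proof -
    let ?L = "(length \<circ> letters) ` Poly_Mapping.keys p"
    have "Max ?L \<in> ?L"
      using that by (intro Max_in) auto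
    then obtain w where w: "w \<in> Poly_Mapping.keys p" "Max ?L = length (letters w)"
      by auto
    have "length (letters w') \<le> length (letters w)" if "w' \<in> Poly_Mapping.keys p" for w'
      unfolding w(2)[symmetric] using that by (intro Max_ge) auto
    with w(1) show ?thesis by blast
  qed
  obtain q where q: "q \<in> Poly_Mapping.keys y"
      "\<And>q'. q' \<in> Poly_Mapping.keys y \<Longrightarrow> length (letters q') \<le> length (letters q)"
    using arg_max[OF y(2)] by blast
  obtain p where p: "p \<in> Poly_Mapping.keys n"
      "\<And>p'. p' \<in> Poly_Mapping.keys n \<Longrightarrow> length (letters p') \<le> length (letters p)"
    using arg_max[OF n(2)] by blast
  have "letters q \<in> normal v"
    using y q by (auto simp: wspan_def)
  then obtain as where as: "letters q = as @ [Vertex v]"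
    using normal_last[of "letters q" v] by (metis append_butlast_last_id normal_not_Nil)
  then have "q = Word (as @ [Vertex v])"
    by (cases q) simp
  then show ?thesis
    using q p as
    by (intro act_nonzero_of_top[OF y(1) n(1), of "length as" "length (letters p)" as "letters p"] two)
      (auto simp: in_keys_iff)
qed

end

context lpa
begin

lemma act_nonzero:
  assumes two: "\<And>c h. h \<in> hedges H \<Longrightarrow> 2 \<le> deg c h"
    and n: "n \<in> wspan {l \<in> normal u. src (hd l) = v}" "n \<noteq> 0" and v: "v \<in> hverts H"
    and y: "y \<in> carrier free_alg" "act y (vertex_elt v) \<noteq> 0"
  shows "act y n \<noteq> 0"
proof -
  let ?z = "act y (vertex_elt v)"
  have n': "n \<in> nspan"
    by (rule wspan_mono[OF _ n(1)]) auto
  have "?z - y * vertex_elt v \<in> rel_ideal"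
    by (rule act_cong[OF wspan_normal_nspan[OF vertex_elt_in_wspan[OF v]] y(1)])
  from act_rel_ideal[OF this n'] have "act ?z n = act y n"
    by (simp add: klinear_diff[OF klinear_act_left] act_mult act_gen_Vertex_id[OF n(1)])
  moreover have "act ?z n \<noteq> 0"
    by (rule act_normal_nonzero[OF two act_in_wspan_normal[OF vertex_elt_in_wspan[OF v] y(1)] y(2) n])
  ultimately show ?thesis by simp
qed

lemma act_gen_nonzero:
  assumes two: "\<And>c h. h \<in> hedges H \<Longrightarrow> 2 \<le> deg c h"
    and n: "n \<in> wspan {l \<in> normal u. src (hd l) = rng a}" "n \<noteq> 0" and a: "a \<in> edge_gens H"
  shows "act_gen a n \<noteq> 0"
proof -
  have "lact a [Vertex (rng a)] = word_elt [a, Vertex (rng a)]"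
    using a by (intro lact_free) auto
  then have "act (generator a) (vertex_elt (rng a)) \<noteq> (0 :: _ \<Rightarrow>\<^sub>0 'a)"
    unfolding act_generator unfolding generator_def act_gen_word_elt
    by (metis lookup_single_eq lookup_zero zero_neq_one)
  then have "act (generator a) n \<noteq> 0"
    using a src_rng_in_hverts[OF edge_gens_subset[OF a]]
    by (intro act_nonzero[OF two n]) (auto intro: gen_in_free_alg edge_gens_subset)
  then show ?thesis by simp
qed

lemma act_walk_nonzero:
  assumes two: "\<And>c h. h \<in> hedges H \<Longrightarrow> 2 \<le> deg c h"
    and n: "n \<in> wspan {l \<in> normal u. src (hd l) = v}" "n \<noteq> 0"
    and "pre_digraph.cas (double_graph H sl rl) w p v" "set p \<subseteq> edge_gens H"
  shows "act_word p n \<in> wspan {l \<in> normal u. src (hd l) = w} \<and> act_word p n \<noteq> 0"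
  using assms(4,5)
proof (induction p arbitrary: w)
  case Nil
  then show ?case using n by (simp add: pre_digraph.cas.simps)
next
  case (Cons e p)
  then have e: "src e = w" "e \<in> edge_gens H" "pre_digraph.cas (double_graph H sl rl) (rng e) p v"
    by (auto simp: pre_digraph.cas.simps double_graph_def)
  with Cons have IH: "act_word p n \<in> wspan {l \<in> normal u. src (hd l) = rng e}" "act_word p n \<noteq> 0"
    by auto
  have "act_word p n \<in> wspan (normal u)"
    by (rule wspan_mono[OF _ IH(1)]) auto
  then have "act_gen e (act_word p n) \<in> wspan {l \<in> normal u. src (hd l) = src e}"
    by (rule act_gen_in_wspan[OF _ edge_gens_subset[OF e(2)]])
  with act_gen_nonzero[OF two IH e(2)] e(1) show ?case
    by simp
qed

lemma lookup_act_gen_Vertex: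
  assumes "n \<in> wspan (normal u)"
  shows "Poly_Mapping.lookup (act_gen (Vertex (src (hd l))) n) (Word l) = Poly_Mapping.lookup n (Word l)"
proof -
  have "Poly_Mapping.lookup (lact (Vertex (src (hd l))) (letters w)) (Word l) = (if w = Word l then 1 else (0 :: 'a))"
    if "w \<in> Poly_Mapping.keys n" for w
  proof -
    have "letters w \<in> normal u"
      using that assms by (simp add: wspan_def)
    then obtain x m where w: "letters w = x # m"
      by (cases "letters w") auto
    then have "w = Word (x # m)"
      by (cases w) simp
    then show ?thesis
      by (auto simp: lact_Vertex lookup_word_elt)
  qed
  then have "Poly_Mapping.lookup (act_gen (Vertex (src (hd l))) n) (Word l) =
      (\<Sum>w\<in>Poly_Mapping.keys n. if w = Word l then Poly_Mapping.lookup n w else 0)"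
    unfolding act_gen_def lin_ext_def lookup_sum lookup_scale by (intro sum.cong) auto
  then show ?thesis
    by (simp add: in_keys_iff)
qed

lemma rel_ideal_prime:
  assumes two: "\<And>c h. h \<in> hedges H \<Longrightarrow> 2 \<le> deg c h"
    and connected: "connected_hypergraph H sl rl"
    and x: "x \<in> carrier free_alg" "x \<notin> rel_ideal" and y: "y \<in> carrier free_alg" "y \<notin> rel_ideal"
  shows "\<exists>r \<in> carrier free_alg. x * (r * y) \<notin> rel_ideal"
proof -
  obtain u where u: "u \<in> hverts H" "act y (vertex_elt u) \<noteq> 0"
    using act_faithful y by blast
  obtain w where w: "w \<in> hverts H" "act x (vertex_elt w) \<noteq> 0"
    using act_faithful x by blast
  let ?n = "act y (vertex_elt u)"
  have n: "?n \<in> wspan (normal u)"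
    by (rule act_in_wspan_normal[OF vertex_elt_in_wspan[OF u(1)] y(1)])
  obtain l where l: "Poly_Mapping.lookup ?n (Word l) \<noteq> 0"
    using u(2) by (metis lookup_zero poly_mapping_eqI word.exhaust)
  define v where "v = src (hd l)"
  have "l \<in> normal u"
    using lookup_wspan[OF n] l by blast
  then have "hd l \<in> lpa_gens H"
    using normal_subset[of l u] hd_in_set[of l] by (cases "l = []") auto
  then have v: "v \<in> hverts H"
    using src_rng_in_hverts unfolding v_def by blast
  obtain p where p: "pre_digraph.awalk (double_graph H sl rl) w p v"
    using connected w(1) v unfolding connected_hypergraph_def by blast
  then have p_walk: "pre_digraph.cas (double_graph H sl rl) w p v" "set p \<subseteq> edge_gens H"
    by (auto simp: pre_digraph.awalk_def double_graph_def)
  have "act_gen (Vertex v) ?n \<in> wspan {l \<in> normal u. src (hd l) = src (Vertex v)}"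
    using v by (intro act_gen_in_wspan[OF n]) simp
  moreover have "act_gen (Vertex v) ?n \<noteq> 0"
    using lookup_act_gen_Vertex[OF n, of l] l unfolding v_def by auto
  ultimately have m: "act_word p (act_gen (Vertex v) ?n) \<in> wspan {l \<in> normal u. src (hd l) = w}"
      "act_word p (act_gen (Vertex v) ?n) \<noteq> 0"
    using act_walk_nonzero[OF two _ _ p_walk, of "act_gen (Vertex v) ?n" u] by simp_all
  have "act x (act_word p (act_gen (Vertex v) ?n)) \<noteq> 0"
    by (rule act_nonzero[OF two m w(1) x(1) w(2)])
  then have "act (x * (word_elt (p @ [Vertex v]) * y)) (vertex_elt u) \<noteq> 0"
    by (simp add: act_mult)
  then have "x * (word_elt (p @ [Vertex v]) * y) \<notin> rel_ideal"
    using act_rel_ideal wspan_normal_nspan[OF vertex_elt_in_wspan[OF u(1)]] by blast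
  moreover have "word_elt (p @ [Vertex v]) \<in> carrier free_alg"
    using p_walk(2) v by (intro single_in_free_algebra) (auto intro: edge_gens_subset)
  ultimately show ?thesis by blast
qed

lemma rel_ideal_proper: "rel_ideal \<noteq> carrier (free_alg :: ('k::field, _) module)"
proof
  assume eq: "rel_ideal = carrier (free_alg :: ('k, _) module)"
  obtain v where v: "v \<in> hverts H"
    using nonempty hsource by fastforce
  then have "vertex_elt v \<in> (rel_ideal :: (('v, 'e) lpa_gen word \<Rightarrow>\<^sub>0 'k) set)"
    unfolding eq by (intro gen_in_free_alg) simp
  then have "act (vertex_elt v) (vertex_elt v) = (0 :: ('v, 'e) lpa_gen word \<Rightarrow>\<^sub>0 'k)"
    by (rule act_rel_ideal[OF _ wspan_normal_nspan[OF vertex_elt_in_wspan[OF v]]])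
  moreover have "act (vertex_elt v) (vertex_elt v) = (word_elt [Vertex v] :: ('v, 'e) lpa_gen word \<Rightarrow>\<^sub>0 'k)"
    by (simp add: generator_def lact_Vertex)
  ultimately have "word_elt [Vertex v] = (0 :: ('v, 'e) lpa_gen word \<Rightarrow>\<^sub>0 'k)"
    by (simp only:)
  then show False
    by (metis lookup_single_eq lookup_zero zero_neq_one)
qed

end

theorem corollary43:
  fixes H :: "('v, 'e) hypergraph" and sl rl :: "'e \<Rightarrow> 'v list"
  assumes "hypergraph H"
    and "listings H sl rl"
    and "connected_hypergraph H sl rl"
    and "\<And>h. h \<in> hedges H \<Longrightarrow> size (hsource H h) \<ge> 2 \<and> size (hrange H h) \<ge> 2"
  shows "prime_ring (leavitt_path_algebra H sl rl
    :: ('k::field, (('v, 'e) lpa_gen word \<Rightarrow>\<^sub>0 'k) set) module)"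
proof -
  interpret lpa H sl rl
    by (intro lpa.intro lpa_axioms.intro assms)
  have two: "2 \<le> deg c h" if "h \<in> hedges H" for c h
    using assms(4)[OF that] size_sides[OF that] by (simp add: side_def)
  show ?thesis
    unfolding leavitt_path_algebra_def presented_algebra_def
  proof (rule quotient_algebra_prime_ring)
    show "two_sided_ideal rel_ideal (free_alg :: ('k, _) module)"
      using algebra_ideal_rel_ideal unfolding algebra_ideal_def by (rule conjunct1)
    show "rel_ideal \<noteq> carrier (free_alg :: ('k, _) module)"
      by (rule rel_ideal_proper)
  qed (use rel_ideal_prime[OF two assms(3)] in simp)
qed

end
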